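(* Let $\epsilon\in(0,1)$ and let $W\in\mathcal{P}(\mathcal{Y}|\mathcal{X})$ be a singular, symmetric channel with $V_\epsilon(W)>0$. Then there is a constant $K(\epsilon,W)>0$ depending only on $\epsilon$ and $W$ such that for every $N$, $$\ln M^*_{\mathrm{fb}}(N,\epsilon)\le N\,C(W)+\sqrt{N\,V_\epsilon(W)}\,\Phi^{-1}(\epsilon)+K(\epsilon,W).$$
   Context: $\mathcal{X},\mathcal{Y}$ finite; the channel is used memorylessly. A channel is symmetric (Gallager) if its outputs can be partitioned into subsets such that, within each subset, each row of the transition submatrix is a permutation of each other row and each column a permutation of each other column. A symmetric channel is singular if $W(y|x)W(y|z)>0$ implies $W(y|x)=W(y|z)$. An $(N,R)$ code with ideal feedback has message set $\{1,\dots,\lceil e^{NR}\rceil\}$, encoding maps $f_n:\mathcal{M}\times\mathcal{Y}^{n-1}\to\mathcal{X}$ and a decoder $\varphi:\mathcal{Y}^N\to\mathcal{M}$; $M^*_{\mathrm{fb}}(N,\epsilon)$ is the largest message-set size $\lceil e^{NR}\rceil$ for which some $(N,R)$ code with ideal feedback has average error probability (uniform messages) at most $\epsilon$. $\Phi$ is the standard Gaussian CDF, $C(W)$ the capacity. For $P\in\mathcal{P}(\mathcal{X})$, $q_P(y)=\sum_xP(x)W(y|x)$ and $V(P,W)=\sum_{x,y}P(x)W(y|x)\big[\ln\frac{W(y|x)}{q_P(y)}-\sum_bW(b|x)\ln\frac{W(b|x)}{q_P(b)}\big]^2$. $V_\epsilon(W)=\min_{Q:I(Q;W)=C(W)}V(Q,W)$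 if $\epsilon<1/2$ and $\max_{Q:I(Q;W)=C(W)}V(Q,W)$ if $\epsilon\ge 1/2$. *)

theory Defs
  imports "HOL-Probability.Probability" "HOL-Library.Disjoint_Sets"
begin

definition channel :: "('x::finite \<Rightarrow> 'y::finite \<Rightarrow> real) \<Rightarrow> bool" where
  "channel W \<longleftrightarrow> (\<forall>x y. W x y \<ge> 0) \<and> (\<forall>x. (\<Sum>y\<in>UNIV. W x y) = 1)"

definition input_dists :: "('x::finite \<Rightarrow> real) set" where
  "input_dists = {P. (\<forall>x. P x \<ge> 0) \<and> (\<Sum>x\<in>UNIV. P x) = 1}"

definition out_dist :: "('x::finite \<Rightarrow> real) \<Rightarrow> ('x \<Rightarrow> 'y::finite \<Rightarrow> real) \<Rightarrow> 'y \<Rightarrow> real" where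
  "out_dist P W y = (\<Sum>x\<in>UNIV. P x * W x y)"

definition mutual_info :: "('x::finite \<Rightarrow> real) \<Rightarrow> ('x \<Rightarrow> 'y::finite \<Rightarrow> real) \<Rightarrow> real" where
  "mutual_info P W = (\<Sum>x\<in>UNIV. \<Sum>y\<in>UNIV. P x * W x y * ln (W x y / out_dist P W y))"

definition capacity :: "('x::finite \<Rightarrow> 'y::finite \<Rightarrow> real) \<Rightarrow> real" where
  "capacity W = Sup ((\<lambda>P. mutual_info P W) ` input_dists)"

definition cond_div :: "('x::finite \<Rightarrow> real) \<Rightarrow> ('x \<Rightarrow> 'y::finite \<Rightarrow> real) \<Rightarrow> 'x \<Rightarrow> real" where
  "cond_div P W x = (\<Sum>b\<in>UNIV. W x b * ln (W x b / out_dist P W b))"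

definition dispersion :: "('x::finite \<Rightarrow> real) \<Rightarrow> ('x \<Rightarrow> 'y::finite \<Rightarrow> real) \<Rightarrow> real" where
  "dispersion P W = (\<Sum>x\<in>UNIV. \<Sum>y\<in>UNIV. P x * W x y *
      (ln (W x y / out_dist P W y) - cond_div P W x)\<^sup>2)"

definition cap_achieving :: "('x::finite \<Rightarrow> 'y::finite \<Rightarrow> real) \<Rightarrow> ('x \<Rightarrow> real) set" where
  "cap_achieving W = {Q \<in> input_dists. mutual_info Q W = capacity W}"

text \<open>V_eps(W): min over capacity-achieving inputs if eps < 1/2, max otherwise
  (the min/max are attained; Inf/Sup are used to denote them).\<close>
definition V_eps :: "real \<Rightarrow> ('x::finite \<Rightarrow> 'y::finite \<Rightarrow> real) \<Rightarrow> real" where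
  "V_eps \<epsilon> W = (if \<epsilon> < 1/2 then Inf ((\<lambda>Q. dispersion Q W) ` cap_achieving W)
                  else Sup ((\<lambda>Q. dispersion Q W) ` cap_achieving W))"

definition symmetric_channel :: "('x::finite \<Rightarrow> 'y::finite \<Rightarrow> real) \<Rightarrow> bool" where
  "symmetric_channel W \<longleftrightarrow> (\<exists>Ps. partition_on (UNIV::'y set) Ps \<and>
     (\<forall>B\<in>Ps.
        (\<forall>x x'. \<exists>\<sigma>. bij_betw \<sigma> B B \<and> (\<forall>y\<in>B. W x' y = W x (\<sigma> y))) \<and>
        (\<forall>y\<in>B. \<forall>y'\<in>B. \<exists>\<tau>::'x \<Rightarrow> 'x. bij \<tau> \<and> (\<forall>x. W x y' = W (\<tau> x) y))))"

definition singular_channel :: "('x::finite \<Rightarrow> 'y::finite \<Rightarrow> real) \<Rightarrow> bool" where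
  "singular_channel W \<longleftrightarrow> (\<forall>x z y. W x y * W z y > 0 \<longrightarrow> W x y = W z y)"

text \<open>Feedback code with M messages {1..M} and blocklength N:
  encoder f i m ys gives the (i+1)-th input (i < N) from message m and the
  past outputs ys (of length i); decoder dec maps output sequences of length N
  to messages. Probability of output sequence ys given m is the product below.\<close>
definition fb_out_prob ::
  "('x::finite \<Rightarrow> 'y::finite \<Rightarrow> real) \<Rightarrow> nat \<Rightarrow> (nat \<Rightarrow> nat \<Rightarrow> 'y list \<Rightarrow> 'x) \<Rightarrow> nat \<Rightarrow> 'y list \<Rightarrow> real" where
  "fb_out_prob W N f m ys = (\<Prod>i<N. W (f i m (take i ys)) (ys ! i))"

definition fb_avg_error ::
  "('x::finite \<Rightarrow> 'y::finite \<Rightarrow> real) \<Rightarrow> nat \<Rightarrow> nat \<Rightarrow> (nat \<Rightarrow> nat \<Rightarrow> 'y list \<Rightarrow> 'x) \<Rightarrow> ('y list \<Rightarrow> nat) \<Rightarrow> real" where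
  "fb_avg_error W N M f dec = (1 / real M) * (\<Sum>m\<in>{1..M}.
      \<Sum>ys\<in>{ys. length ys = N}. (if dec ys \<noteq> m then fb_out_prob W N f m ys else 0))"

definition fb_code_exists ::
  "('x::finite \<Rightarrow> 'y::finite \<Rightarrow> real) \<Rightarrow> nat \<Rightarrow> nat \<Rightarrow> real \<Rightarrow> bool" where
  "fb_code_exists W N M \<epsilon> \<longleftrightarrow> (\<exists>(f :: nat \<Rightarrow> nat \<Rightarrow> 'y list \<Rightarrow> 'x) (dec :: 'y list \<Rightarrow> nat).
      (\<forall>ys. length ys = N \<longrightarrow> dec ys \<in> {1..M}) \<and> fb_avg_error W N M f dec \<le> \<epsilon>)"

definition M_star_fb :: "('x::finite \<Rightarrow> 'y::finite \<Rightarrow> real) \<Rightarrow> nat \<Rightarrow> real \<Rightarrow> nat" where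
  "M_star_fb W N \<epsilon> = Max {M. \<exists>R::real. M = nat \<lceil>exp (real N * R)\<rceil> \<and> fb_code_exists W N M \<epsilon>}"

definition Phi :: "real \<Rightarrow> real" where
  "Phi x = measure (density lborel std_normal_density) {..x}"

definition Phi_inv :: "real \<Rightarrow> real" where
  "Phi_inv p = (THE z. Phi z = p)"

end

theory Submission
  imports Defs
begin

text \<open>For a singular symmetric channel the information density of an input-output pair is a function of the
  output letter alone, and its law does not depend on the input. So, whatever the encoder does with the
  feedback, the accumulated information density is a random walk with independent steps, whose mean is the
  capacity and whose variance is the dispersion. If \<open>S\<close> is its value after \<open>N\<close> steps, a code with
  \<open>M\<close> messages decodes correctly with probability at most \<open>E (min 1 (exp S / M))\<close>. The
  Berry--Esseen theorem, proved here by Stein's method with Bolthausen's induction, turns this into the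
  claimed bound with an error of order \<open>1 / sqrt N\<close> in the probability, hence a constant in
  \<open>ln M\<close>.\<close>

section \<open>Gaussian tails and the Stein equation\<close>

text \<open>A plain threshold test in place of \<open>min 1 (exp S / M)\<close> would need a slack
  of \<open>ln N / 2\<close> to make its second error term as small as \<open>1 / sqrt N\<close>.
  The full function loses only a constant: its transition region has bounded width in
  \<open>S\<close>, hence width of order \<open>1 / sqrt N\<close> after normalisation.
  Berry--Esseen speaks of half-lines, so this function is reached through a mixture of their
  indicators. Stein's equation needs a continuous test function, so an indicator is replaced by a
  ramp of width \<open>l\<close>. The smoothing costs about \<open>l\<close>, and the slope
  \<open>1 / l\<close> is felt only in a window whose probability is bounded through
  \<open>l\<close> and the error \<delta> of the shorter walk. With \<open>l\<close> of order
  \<open>1 / sqrt n\<close>, this gives an error of order \<open>1 / sqrt n\<close> plus a fixed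
  fraction of \<delta>. The minimum and the maximum in \<open>V_eps\<close> coincide, because every
  capacity-achieving input has the output law of the uniform input.\<close>

text \<open>For \<open>u\<close> near \<open>w\<close>, splitting off the fixed half-line below
  \<open>w - 1\<close> leaves an integral over a compact interval, and \<open>w\<close> is interior
  to \<open>{w - 1..w + 1}\<close>, where the fundamental theorem applies.\<close>

lemma set_integral_atMost_has_real_derivative:
  fixes g :: "real \<Rightarrow> real"
  assumes "continuous_on UNIV g" and int: "integrable lborel g"
  shows "((\<lambda>w. LINT x:{..w}|lborel. g x) has_real_derivative g w) (at w)"
proof -
  have si: "set_integrable lborel S g" if "S \<in> sets borel" for S
    using int that unfolding set_integrable_def
    by (intro integrable_mult_indicator) auto
  let ?c = "LINT x:{..<w - 1}|lborel. g x"
  have split: "(LINT x:{..u}|lborel. g x) = ?c + integral {w - 1..u} g" if "u > w - 1" for u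
  proof -
    have "{..u} = {..<w - 1} \<union> {w - 1..u}"
      using that by auto
    moreover have "(LINT x:{..<w - 1} \<union> {w - 1..u}|lborel. g x) = ?c + (LINT x:{w - 1..u}|lborel. g x)"
      using si by (intro set_integral_Un) auto
    ultimately show ?thesis
      using set_borel_integral_eq_integral(2)[OF si] by simp
  qed
  have "((\<lambda>u. integral {w - 1..u} g) has_real_derivative g w) (at w within {w - 1..w + 1})"
    using assms(1) by (intro integral_has_real_derivative) (auto intro: continuous_on_subset)
  then have "((\<lambda>u. integral {w - 1..u} g) has_real_derivative g w) (at w)"
    by (simp add: at_within_Icc_at)
  then have "((\<lambda>u. ?c + integral {w - 1..u} g) has_real_derivative g w) (at w)"
    by (auto intro!: derivative_eq_intros)
  moreover have "\<forall>\<^sub>F u in nhds w. (LINT x:{..u}|lborel. g x) = ?c + integral {w - 1..u} g"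
    using eventually_nhds_in_open[of "{w - 1<..}" w] split
    by (auto elim: eventually_mono)
  ultimately show ?thesis
    by (subst DERIV_cong_ev[OF refl _ refl])
qed

section \<open>The standard normal density and distribution function\<close>

lemma std_normal_density_has_real_derivative:
  "(std_normal_density has_real_derivative - x * std_normal_density x) (at x)"
  unfolding std_normal_density_def
  by (auto intro!: derivative_eq_intros simp: field_simps)

lemma std_normal_density_minus: "std_normal_density (- x) = std_normal_density x"
  by (simp add: std_normal_density_def)

lemma continuous_on_std_normal_density: "continuous_on S std_normal_density"
  using std_normal_density_has_real_derivative
  by (meson DERIV_continuous continuous_at_imp_continuous_on)

lemma integrable_std_normal_density: "integrable lborel std_normal_density"
  using integrable_std_normal_moment[of 0] by simp

lemma std_normal_density_le_1: "std_normal_density x \<le> 1"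
proof -
  have "1 \<le> sqrt (2 * pi)"
    using pi_gt3 by simp
  then have "exp (- x\<^sup>2 / 2) \<le> sqrt (2 * pi)"
    by (rule order_trans[rotated]) simp
  then show ?thesis
    unfolding std_normal_density_def by (simp add: divide_le_eq)
qed

lemma Phi_eq_set_integral: "Phi w = (LINT x:{..w}|lborel. std_normal_density x)"
proof -
  interpret real_distribution std_normal_distribution
    by (rule real_dist_normal_dist)
  have "Phi w = (\<integral>x. indicator {..w} x \<partial>std_normal_distribution)"
    by (simp add: Phi_def)
  also have "\<dots> = (\<integral>x. std_normal_density x *\<^sub>R indicator {..w} x \<partial>lborel)"
    by (rule integral_density) auto
  also have "\<dots> = (LINT x:{..w}|lborel. std_normal_density x)"
    by (simp add: set_lebesgue_integral_def mult.commute)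
  finally show ?thesis .
qed

lemma Phi_has_real_derivative: "(Phi has_real_derivative std_normal_density w) (at w)"
  using set_integral_atMost_has_real_derivative
    [OF continuous_on_std_normal_density integrable_std_normal_density]
  by (simp add: Phi_eq_set_integral[abs_def])

lemma Phi_eq_cdf: "Phi = cdf std_normal_distribution"
  by (auto simp: Phi_def cdf_def)

lemma Phi_tendsto_at_top: "(Phi \<longlongrightarrow> 1) at_top"
  unfolding Phi_eq_cdf
  using real_distribution.cdf_lim_at_top_prob[OF real_dist_normal_dist] .

lemma Phi_tendsto_at_bot: "(Phi \<longlongrightarrow> 0) at_bot"
  unfolding Phi_eq_cdf
  using real_dist_normal_dist
  by (intro finite_borel_measure.cdf_lim_at_bot)
     (simp add: real_distribution.finite_borel_measure_M)

lemma Phi_nonneg: "0 \<le> Phi z"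
  by (simp add: Phi_def)

lemma Phi_le_1: "Phi z \<le> 1"
  unfolding Phi_eq_cdf
  using real_distribution.cdf_bounded_prob[OF real_dist_normal_dist] .

lemma Phi_strict_mono: "x < y \<Longrightarrow> Phi x < Phi y"
  using Phi_has_real_derivative normal_density_pos[of 1 0]
  by (intro DERIV_pos_imp_increasing[of x y Phi]) auto

lemma Phi_mono: "x \<le> y \<Longrightarrow> Phi x \<le> Phi y"
  using Phi_strict_mono[of x y] by (cases "x = y") auto

lemma Phi_diff_le:
  assumes "x \<le> y"
  shows "Phi y - Phi x \<le> y - x"
proof (cases "x = y")
  case False
  then obtain z where "Phi y - Phi x = (y - x) * std_normal_density z"
    using MVT2[of x y Phi std_normal_density] assms Phi_has_real_derivative by auto
  also have "\<dots> \<le> (y - x) * 1"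
    using assms std_normal_density_le_1 by (intro mult_left_mono) auto
  finally show ?thesis by simp
qed simp

lemma isCont_Phi: "isCont Phi x"
  using Phi_has_real_derivative DERIV_isCont by blast

text \<open>Justifies the definite description in \<open>Phi_inv\<close>: existence by the
  intermediate value theorem, uniqueness by strict monotonicity.\<close>

lemma Phi_Phi_inv:
  assumes "0 < p" and "p < 1"
  shows "Phi (Phi_inv p) = p"
proof -
  obtain a where a: "Phi a < p"
    using order_tendstoD(2)[OF Phi_tendsto_at_bot assms(1)]
    by (auto simp: eventually_at_bot_linorder)
  obtain b where b: "Phi b > p"
    using order_tendstoD(1)[OF Phi_tendsto_at_top assms(2)]
    by (auto simp: eventually_at_top_linorder)
  have "a \<le> b"
    using a b Phi_mono[of b a] by linarith
  then obtain z where z: "Phi z = p"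
    using IVT[of Phi a p b] a b isCont_Phi by auto
  have "x = z" if "Phi x = p" for x
    using that z Phi_strict_mono[of x z] Phi_strict_mono[of z x] by (cases x z rule: linorder_cases) auto
  with z show ?thesis
    unfolding Phi_inv_def by (intro theI[of "\<lambda>z. Phi z = p"])
qed

text \<open>The abstract \<open>T\<close> covers the upper tail \<open>1 - Phi x\<close> and the
  reflected lower tail \<open>Phi (- x)\<close> at once.\<close>

lemma gaussian_tail_bounds:
  assumes deriv: "\<And>x. (T has_real_derivative - std_normal_density x) (at x)"
    and lim: "(T \<longlongrightarrow> 0) at_top" and "T 0 \<le> 1" and "0 \<le> x"
  shows "x * T x \<le> std_normal_density x" and "T x \<le> 6 * std_normal_density x"
proof -
  have A: "y * T y \<le> std_normal_density y" if "0 < y" for y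
  proof -
    \<comment> \<open>The derivatives of the two terms cancel up to
      \<open>- std_normal_density z / z\<^sup>2\<close>, so \<open>k\<close> decreases to its limit
      0 and is nonnegative.\<close>
    define k where "k z = std_normal_density z / z - T z" for z
    have k': "(k has_real_derivative - (std_normal_density z / z\<^sup>2)) (at z)" if "z > 0" for z
      unfolding k_def using that
      by (auto intro!: derivative_eq_intros deriv std_normal_density_has_real_derivative
          simp: field_simps power2_eq_square)
    have anti: "k v \<le> k u" if "0 < u" "u \<le> v" for u v
    proof (rule DERIV_nonpos_imp_nonincreasing[OF that(2)])
      fix z assume "u \<le> z" "z \<le> v"
      then show "\<exists>y. (k has_real_derivative y) (at z) \<and> y \<le> 0"
        using k'[of z] that by (intro exI[of _ "- (std_normal_density z / z\<^sup>2)"]) auto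
    qed
    have "((\<lambda>z. std_normal_density z / z) \<longlongrightarrow> 0) at_top"
    proof (rule tendsto_sandwich)
      show "\<forall>\<^sub>F z in at_top. 0 \<le> std_normal_density z / z"
        using eventually_gt_at_top[of 0] by eventually_elim simp
      show "\<forall>\<^sub>F z in at_top. std_normal_density z / z \<le> 1 / z"
        using eventually_gt_at_top[of 0] by eventually_elim (simp add: divide_right_mono std_normal_density_le_1)
      show "((\<lambda>z::real. 1 / z) \<longlongrightarrow> 0) at_top"
        using tendsto_inverse_0_at_top[OF filterlim_ident] by (simp add: inverse_eq_divide)
    qed auto
    from tendsto_diff[OF this lim] have "(k \<longlongrightarrow> 0) at_top"
      by (simp add: k_def[abs_def])
    moreover have "\<forall>\<^sub>F z in at_top. k z \<le> k y"
      using eventually_ge_at_top[of y] by eventually_elim (simp add: anti that)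
    ultimately have "0 \<le> k y"
      by (intro tendsto_upperbound) auto
    then show ?thesis
      using that by (simp add: k_def field_simps)
  qed
  show B: "x * T x \<le> std_normal_density x"
    using A[of x] \<open>0 \<le> x\<close> by (cases "x = 0") auto
  show "T x \<le> 6 * std_normal_density x"
  proof (cases "x \<le> 1")
    case True
    have "T x \<le> T 0"
    proof (rule DERIV_nonpos_imp_nonincreasing[OF \<open>0 \<le> x\<close>])
      fix z assume "0 \<le> z" "z \<le> x"
      then show "\<exists>y. (T has_real_derivative y) (at z) \<and> y \<le> 0"
        using deriv[of z] by (intro exI[of _ "- std_normal_density z"]) auto
    qed
    also have "\<dots> \<le> 1" by fact
    \<comment> \<open>On \<open>[0, 1]\<close> the density is at least \<open>(1 / 2) / 3\<close>:
      the exponential is at least 1/2, and \<open>sqrt (2 * pi)\<close> is at most 3. This is the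
      origin of 6.\<close>
    also have "1 \<le> 6 * std_normal_density x"
    proof -
      have "x\<^sup>2 \<le> 1"
        using True \<open>0 \<le> x\<close> by (simp add: power_le_one)
      then have "exp (- x\<^sup>2 / 2) \<ge> 1 / 2"
        using exp_ge_add_one_self[of "- x\<^sup>2 / 2"] by linarith
      moreover have "sqrt (2 * pi) \<le> sqrt (3\<^sup>2)"
        using pi_less_4 by (intro real_sqrt_le_mono) auto
      then have "sqrt (2 * pi) \<le> 3" by simp
      ultimately show ?thesis
        unfolding std_normal_density_def by (simp add: field_simps)
    qed
    finally show ?thesis .
  next
    case False
    have "T x \<le> 6 * std_normal_density x" if "T x \<ge> 0"
    proof -
      have "T x \<le> x * T x"
        using False that mult_right_mono[of 1 x "T x"] by simp
      then show ?thesis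
        using B by (smt (verit) normal_density_nonneg)
    qed
    then show ?thesis
      by (smt (verit) normal_density_nonneg)
  qed
qed

lemma Phi_upper_tail_bounds:
  assumes "0 \<le> x"
  shows "x * (1 - Phi x) \<le> std_normal_density x" and "1 - Phi x \<le> 6 * std_normal_density x"
proof -
  have "((\<lambda>x. 1 - Phi x) has_real_derivative - std_normal_density x) (at x)" for x
    by (auto intro!: derivative_eq_intros Phi_has_real_derivative)
  moreover have "((\<lambda>x. 1 - Phi x) \<longlongrightarrow> 0) at_top"
    using tendsto_diff[OF tendsto_const Phi_tendsto_at_top, of 1] by simp
  ultimately show "x * (1 - Phi x) \<le> std_normal_density x" "1 - Phi x \<le> 6 * std_normal_density x"
    using gaussian_tail_bounds[of "\<lambda>x. 1 - Phi x"] assms Phi_nonneg[of 0] by simp_all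
qed

lemma Phi_lower_tail_bounds:
  assumes "x \<le> 0"
  shows "- x * Phi x \<le> std_normal_density x" and "Phi x \<le> 6 * std_normal_density x"
proof -
  have "((\<lambda>x. Phi (- x)) has_real_derivative - std_normal_density x) (at x)" for x
    using DERIV_chain2[OF Phi_has_real_derivative DERIV_minus[OF DERIV_ident], of x UNIV]
    by (simp add: std_normal_density_minus)
  moreover have "((\<lambda>x. Phi (- x)) \<longlongrightarrow> 0) at_top"
    using filterlim_compose[OF Phi_tendsto_at_bot filterlim_uminus_at_bot_at_top] .
  ultimately show "- x * Phi x \<le> std_normal_density x" "Phi x \<le> 6 * std_normal_density x"
    using gaussian_tail_bounds[of "\<lambda>x. Phi (- x)" "- x"] assms Phi_le_1[of 0]
    by (simp_all add: std_normal_density_minus)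
qed

text \<open>The solution is the integral of \<open>(h - c) * std_normal_density\<close> up to
  \<open>w\<close>, divided by the density at \<open>w\<close>. Centring by \<open>c\<close> makes
  the total integral vanish, so this integral is bounded by either Gaussian tail. The equation turns
  the error \<open>E h(S) - c\<close> into \<open>E (f' S - S * f S)\<close>.\<close>

lemma stein_equation:
  fixes h :: "real \<Rightarrow> real"
  assumes cont: "continuous_on UNIV h" and h0: "\<And>x. 0 \<le> h x" and h1: "\<And>x. h x \<le> 1"
  defines "c \<equiv> LINT x|lborel. h x * std_normal_density x"
  obtains f where "\<And>w. (f has_real_derivative w * f w + h w - c) (at w)"
    and "\<And>w. \<bar>f w\<bar> \<le> 6" and "\<And>w. \<bar>w * f w\<bar> \<le> 1"
proof -
  let ?\<phi> = std_normal_density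
  have hm [measurable]: "h \<in> borel_measurable borel"
    using cont by (rule borel_measurable_continuous_onI)
  have hint: "integrable lborel (\<lambda>x. h x * ?\<phi> x)"
    by (rule Bochner_Integration.integrable_bound[OF integrable_std_normal_density])
       (auto simp: abs_mult h0 h1 mult_left_le_one_le)
  have tot: "(LINT x|lborel. ?\<phi> x) = 1"
    using integral_std_normal_moment_even[of 0] by simp
  have c0: "0 \<le> c"
    unfolding c_def by (intro integral_nonneg_AE) (auto simp: h0)
  have "c \<le> (LINT x|lborel. ?\<phi> x)"
    unfolding c_def
    by (intro integral_mono hint integrable_std_normal_density) (auto simp: h0 h1 mult_left_le_one_le)
  then have c1: "c \<le> 1"
    by (simp add: tot)
  define H where "H x = (h x - c) * ?\<phi> x" for x
  have Hcont: "continuous_on UNIV H"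
    unfolding H_def by (intro continuous_intros cont continuous_on_std_normal_density)
  have Hint: "integrable lborel H"
    unfolding H_def left_diff_distrib
    by (intro Bochner_Integration.integrable_diff hint integrable_mult_right integrable_std_normal_density)
  have Hbound: "\<bar>H x\<bar> \<le> ?\<phi> x" for x
  proof -
    have "\<bar>h x - c\<bar> \<le> 1"
      using c0 c1 h0[of x] h1[of x] by linarith
    then show ?thesis
      by (simp add: H_def abs_mult mult_left_le_one_le)
  qed
  have Htot: "(LINT x|lborel. H x) = 0"
  proof -
    have "(LINT x|lborel. H x) = (LINT x|lborel. h x * ?\<phi> x) - c * (LINT x|lborel. ?\<phi> x)"
      unfolding H_def left_diff_distrib
      using hint integrable_std_normal_density by simp
    then show ?thesis by (simp add: tot c_def)
  qed
  have si: "set_integrable lborel S g" if "S \<in> sets borel" "integrable lborel g" for S and g :: "real \<Rightarrow> real"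
    using that unfolding set_integrable_def by (intro integrable_mult_indicator) auto
  have bnd: "\<bar>LINT x:S|lborel. H x\<bar> \<le> (LINT x:S|lborel. ?\<phi> x)" if "S \<in> sets borel" for S
  proof -
    have "\<bar>LINT x:S|lborel. H x\<bar> \<le> (LINT x:S|lborel. \<bar>H x\<bar>)"
      using set_integral_norm_bound[OF si[OF that Hint]] by simp
    also have "\<dots> \<le> (LINT x:S|lborel. ?\<phi> x)"
      using si[OF that] Hint integrable_std_normal_density Hbound
      by (intro set_integral_mono) auto
    finally show ?thesis .
  qed
  have comp: "(LINT x:{w<..}|lborel. g x) = (LINT x|lborel. g x) - (LINT x:{..w}|lborel. g x)"
    if "integrable lborel g" for w and g :: "real \<Rightarrow> real"
  proof -
    have "{..w} \<union> {w<..} = UNIV" by auto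
    then have "(LINT x|lborel. g x) = (LINT x:{..w} \<union> {w<..}|lborel. g x)"
      by (simp add: set_lebesgue_integral_def)
    also have "\<dots> = (LINT x:{..w}|lborel. g x) + (LINT x:{w<..}|lborel. g x)"
      using si that by (intro set_integral_Un) auto
    finally show ?thesis by simp
  qed
  define F where "F w = (LINT x:{..w}|lborel. H x)" for w
  have F1: "\<bar>F w\<bar> \<le> Phi w" for w
    using bnd[of "{..w}"] by (simp add: F_def Phi_eq_set_integral)
  have F2: "\<bar>F w\<bar> \<le> 1 - Phi w" for w
    using bnd[of "{w<..}"] comp[OF Hint, of w] comp[OF integrable_std_normal_density, of w]
    by (simp add: F_def Phi_eq_set_integral Htot tot)
  have F': "(F has_real_derivative H w) (at w)" for w
    using set_integral_atMost_has_real_derivative[OF Hcont Hint] by (simp add: F_def[abs_def])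
  define f where "f w = F w / ?\<phi> w" for w
  have pos: "?\<phi> w > 0" for w
    by (simp add: normal_density_pos)
  \<comment> \<open>The sign of \<open>w\<close> decides which tail is the small one.\<close>
  have Fb: "\<bar>F w\<bar> \<le> 6 * ?\<phi> w \<and> \<bar>w * F w\<bar> \<le> ?\<phi> w" for w
  proof (cases "0 \<le> w")
    case True
    have "\<bar>w * F w\<bar> \<le> w * (1 - Phi w)"
      using True F2[of w] by (simp add: abs_mult mult_left_mono)
    with F2[of w] Phi_upper_tail_bounds[OF True] show ?thesis by linarith
  next
    case False
    have "\<bar>w * F w\<bar> \<le> - w * Phi w"
      using False F1[of w] by (simp add: abs_mult mult_left_mono_neg)
    with F1[of w] Phi_lower_tail_bounds[of w] False show ?thesis by linarith
  qed
  show ?thesis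
  proof (rule that[of f])
    fix w
    show "\<bar>f w\<bar> \<le> 6" "\<bar>w * f w\<bar> \<le> 1"
      using Fb[of w] pos[of w] by (simp_all add: f_def abs_mult abs_divide field_simps)
    have "(f has_real_derivative (H w * ?\<phi> w - F w * (- w * ?\<phi> w)) / (?\<phi> w * ?\<phi> w)) (at w)"
      unfolding f_def
      using pos[of w] by (intro DERIV_divide F' std_normal_density_has_real_derivative) simp
    moreover have "(H w * ?\<phi> w - F w * (- w * ?\<phi> w)) / (?\<phi> w * ?\<phi> w) = w * f w + h w - c"
      using pos[of w] by (simp add: H_def f_def divide_simps) (simp add: algebra_simps)
    ultimately show "(f has_real_derivative w * f w + h w - c) (at w)"
      by simp
  qed
qed

section \<open>Random walks and the Berry--Esseen theorem\<close>

text \<open>\<open>walk_expect p v n g\<close> is the expectation of \<open>g (S n)\<close> for the random walk \<open>S\<close> with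
  independent steps that take the value \<open>v a\<close> with probability \<open>p a\<close>.\<close>

primrec walk_expect :: "('a::finite \<Rightarrow> real) \<Rightarrow> ('a \<Rightarrow> real) \<Rightarrow> nat \<Rightarrow> (real \<Rightarrow> real) \<Rightarrow> real" where
  "walk_expect p v 0 g = g 0"
| "walk_expect p v (Suc n) g = walk_expect p v n (\<lambda>s. \<Sum>a\<in>UNIV. p a * g (s + v a))"

lemma walk_expect_add:
  "walk_expect p v n (\<lambda>s. g s + h s) = walk_expect p v n g + walk_expect p v n h"
  by (induction n arbitrary: g h) (simp_all add: distrib_left sum.distrib)

lemma walk_expect_cmult: "walk_expect p v n (\<lambda>s. c * g s) = c * walk_expect p v n g"
proof (induction n arbitrary: g)
  case (Suc n)
  have "(\<lambda>s. \<Sum>a\<in>UNIV. p a * (c * g (s + v a))) = (\<lambda>s. c * (\<Sum>a\<in>UNIV. p a * g (s + v a)))"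
    by (simp add: sum_distrib_left mult.left_commute)
  then show ?case by (simp add: Suc)
qed simp

lemma walk_expect_diff:
  "walk_expect p v n (\<lambda>s. g s - h s) = walk_expect p v n g - walk_expect p v n h"
  using walk_expect_add[of p v n g "\<lambda>s. -1 * h s"] walk_expect_cmult[of p v n "-1" h] by simp

lemma walk_expect_sum:
  "walk_expect p v n (\<lambda>s. \<Sum>i\<in>I. g i s) = (\<Sum>i\<in>I. walk_expect p v n (g i))"
proof (induction I rule: infinite_finite_induct)
  case (infinite I)
  then show ?case using walk_expect_cmult[of p v n 0 "\<lambda>_. 0"] by simp
next
  case empty
  then show ?case using walk_expect_cmult[of p v n 0 "\<lambda>_. 0"] by simp
qed (simp add: walk_expect_add)

lemma walk_expect_affine:
  "walk_expect p (\<lambda>a. (v a - \<mu>) / \<sigma>) n g = walk_expect p v n (\<lambda>s. g ((s - real n * \<mu>) / \<sigma>))"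
  by (induction n arbitrary: g) (simp_all add: algebra_simps diff_divide_distrib add_divide_distrib)

section \<open>Ramps: continuous functions between the indicators of \<open>{..z}\<close> and
  \<open>{..z + l}\<close>\<close>

definition ramp :: "real \<Rightarrow> real \<Rightarrow> real \<Rightarrow> real" where
  "ramp z l x = max 0 (min 1 (1 + (z - x) / l))"

lemma ramp_nonneg: "0 \<le> ramp z l x" and ramp_le_1: "ramp z l x \<le> 1"
  by (simp_all add: ramp_def)

lemma continuous_on_ramp: "continuous_on S (ramp z l)"
  unfolding ramp_def[abs_def] divide_inverse by (intro continuous_intros)

lemma ramp_eq_1: "0 < l \<Longrightarrow> x \<le> z \<Longrightarrow> ramp z l x = 1"
  by (simp add: ramp_def max_def min_def)

lemma ramp_eq_0: "0 < l \<Longrightarrow> z + l \<le> x \<Longrightarrow> ramp z l x = 0"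
  by (simp add: ramp_def field_simps max_def min_def)

lemma ramp_lipschitz:
  assumes "0 < l"
  shows "\<bar>ramp z l (w + t) - ramp z l w\<bar> \<le> \<bar>t\<bar> / l"
proof -
  have "\<bar>ramp z l (w + t) - ramp z l w\<bar> \<le> \<bar>(1 + (z - (w + t)) / l) - (1 + (z - w) / l)\<bar>"
    unfolding ramp_def by linarith
  also have "\<dots> = \<bar>t\<bar> / l"
    using assms by (simp add: field_simps)
  finally show ?thesis .
qed

text \<open>The slope \<open>1 / l\<close> matters only near the sloping part. The window is
  half-open so that its probability is a difference of two values of the distribution
  function.\<close>

lemma ramp_increment:
  assumes "0 < l" and "0 < \<tau>" and "\<bar>t\<bar> \<le> \<tau>"
  shows "\<bar>ramp z l (w + t) - ramp z l w\<bar> \<le> \<bar>t\<bar> / l * of_bool (z - 2 * \<tau> < w \<and> w \<le> z + l + \<tau>)"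
proof (cases "z - 2 * \<tau> < w \<and> w \<le> z + l + \<tau>")
  case True
  then show ?thesis using ramp_lipschitz[OF assms(1)] by simp
next
  case False
  then have "w \<le> z \<and> w + t \<le> z \<or> z + l \<le> w \<and> z + l \<le> w + t"
    using assms by auto
  then show ?thesis
    using False assms(1) by (auto simp: ramp_eq_0 ramp_eq_1)
qed

lemma gaussian_ramp_bounds:
  assumes "0 < l"
  shows "Phi z \<le> (LINT x|lborel. ramp z l x * std_normal_density x)"
    and "(LINT x|lborel. ramp z l x * std_normal_density x) \<le> Phi (z + l)"
proof -
  have Phi: "Phi u = (LINT x|lborel. indicator {..u} x * std_normal_density x)" for u
    by (simp add: Phi_eq_set_integral set_lebesgue_integral_def)
  have m: "ramp z l \<in> borel_measurable borel"
    by (intro borel_measurable_continuous_onI continuous_on_ramp)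
  have i: "integrable lborel (\<lambda>x. g x * std_normal_density x)"
    if "g \<in> borel_measurable borel" "\<And>x. 0 \<le> g x" "\<And>x. g x \<le> 1" for g :: "real \<Rightarrow> real"
    by (rule Bochner_Integration.integrable_bound[OF integrable_std_normal_density])
       (use that in \<open>auto simp: abs_mult mult_left_le_one_le\<close>)
  have ir: "integrable lborel (\<lambda>x. ramp z l x * std_normal_density x)"
    by (intro i m ramp_nonneg ramp_le_1)
  have ii: "integrable lborel (\<lambda>x. indicator {..u} x * std_normal_density x)" for u
    by (intro i) (auto simp: indicator_def)
  show "Phi z \<le> (LINT x|lborel. ramp z l x * std_normal_density x)"
    unfolding Phi using assms
    by (intro integral_mono ir ii mult_right_mono) (auto simp: indicator_def ramp_eq_1 ramp_nonneg)
  show "(LINT x|lborel. ramp z l x * std_normal_density x) \<le> Phi (z + l)"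
    unfolding Phi using assms
    by (intro integral_mono ir ii mult_right_mono) (auto simp: indicator_def ramp_eq_0 ramp_le_1)
qed

section \<open>Positivity, moments and normal approximation of walks with probability
  weights\<close>

context
  fixes p :: "'a::finite \<Rightarrow> real" and v :: "'a \<Rightarrow> real"
  assumes p_nonneg: "\<And>a. 0 \<le> p a" and p_sum: "(\<Sum>a\<in>UNIV. p a) = 1"
begin

lemma walk_expect_const: "walk_expect p v n (\<lambda>_. c) = c"
  using p_sum by (induction n) (simp_all flip: sum_distrib_right)

lemma walk_expect_mono:
  "(\<And>s. g s \<le> h s) \<Longrightarrow> walk_expect p v n g \<le> walk_expect p v n h"
  using p_nonneg by (induction n arbitrary: g h) (simp_all add: mult_left_mono sum_mono)

lemma walk_expect_abs_le:
  assumes "\<And>s. \<bar>g s\<bar> \<le> h s"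
  shows "\<bar>walk_expect p v n g\<bar> \<le> walk_expect p v n h"
proof -
  have "walk_expect p v n g \<le> walk_expect p v n h"
    by (rule walk_expect_mono) (use assms in \<open>simp add: abs_le_iff\<close>)
  moreover have "walk_expect p v n (\<lambda>s. -1 * g s) \<le> walk_expect p v n h"
    by (rule walk_expect_mono) (use assms in \<open>simp add: abs_le_iff\<close>)
  ultimately show ?thesis
    unfolding walk_expect_cmult by simp
qed

text \<open>Each of the \<open>n + 1\<close> exchangeable steps contributes the same amount to the expectation of
  \<open>S * g S\<close>.\<close>

lemma walk_expect_times_self:
  "walk_expect p v (Suc n) (\<lambda>s. s * g s)
     = real (Suc n) * walk_expect p v n (\<lambda>s. \<Sum>a\<in>UNIV. p a * (v a * g (s + v a)))"
proof (induction n arbitrary: g)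
  case 0
  then show ?case by simp
next
  case (Suc n)
  define G where "G s = (\<Sum>a\<in>UNIV. p a * g (s + v a))" for s
  define H where "H s = (\<Sum>a\<in>UNIV. p a * (v a * g (s + v a)))" for s
  have "(\<Sum>a\<in>UNIV. p a * ((s + v a) * g (s + v a))) = s * G s + H s" for s
    by (simp add: G_def H_def sum_distrib_left algebra_simps sum.distrib)
  then have "walk_expect p v (Suc (Suc n)) (\<lambda>s. s * g s)
      = walk_expect p v (Suc n) (\<lambda>s. s * G s) + walk_expect p v (Suc n) H"
    by (simp only: walk_expect.simps(2)[of p v "Suc n"] walk_expect_add)
  also have "walk_expect p v (Suc n) (\<lambda>s. s * G s)
      = real (Suc n) * walk_expect p v n (\<lambda>s. \<Sum>b\<in>UNIV. p b * (v b * G (s + v b)))"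
    by (rule Suc)
  also have "(\<lambda>s. \<Sum>b\<in>UNIV. p b * (v b * G (s + v b))) = (\<lambda>s. \<Sum>a\<in>UNIV. p a * H (s + v a))"
    unfolding G_def H_def sum_distrib_left
    by (subst sum.swap) (simp add: algebra_simps)
  finally show ?case
    by (simp add: H_def algebra_simps)
qed

context
  assumes mean: "(\<Sum>a\<in>UNIV. p a * v a) = 0" and var: "(\<Sum>a\<in>UNIV. p a * (v a)\<^sup>2) = 1"
begin

lemma walk_expect_square: "walk_expect p v n (\<lambda>s. s\<^sup>2) = real n"
proof (induction n)
  case (Suc n)
  have "(\<Sum>a\<in>UNIV. p a * (s + v a)\<^sup>2)
      = (\<Sum>a\<in>UNIV. p a) * s\<^sup>2 + 2 * s * (\<Sum>a\<in>UNIV. p a * v a) + (\<Sum>a\<in>UNIV. p a * (v a)\<^sup>2)" for s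
    by (simp add: power2_sum algebra_simps sum.distrib sum_distrib_left sum_distrib_right)
  then show ?case
    using Suc by (simp add: p_sum mean var walk_expect_add walk_expect_const)
qed simp

text \<open>By the arithmetic-geometric mean inequality, \<open>\<bar>s\<bar>\<close> is at most
  \<open>s\<^sup>2 / (2 * r) + r / 2\<close>, and the second moment is known. The scale
  \<open>r = sqrt (Suc n)\<close> is that of the walk with one more step.\<close>

lemma walk_expect_abs_le_sqrt: "walk_expect p v n (\<lambda>s. \<bar>s\<bar>) \<le> sqrt (real (Suc n))"
proof -
  let ?r = "sqrt (real (Suc n))"
  have r: "?r > 0" "?r\<^sup>2 = real (Suc n)" by simp_all
  have "\<bar>s\<bar> \<le> 1 / (2 * ?r) * s\<^sup>2 + ?r / 2" for s
  proof -
    have "0 \<le> (\<bar>s\<bar> - ?r)\<^sup>2" by simp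
    then have "2 * ?r * \<bar>s\<bar> \<le> s\<^sup>2 + ?r\<^sup>2"
      by (simp only: power2_diff) (simp add: algebra_simps)
    then have "\<bar>s\<bar> \<le> (s\<^sup>2 + ?r\<^sup>2) / (2 * ?r)"
      using r(1) by (simp add: pos_le_divide_eq algebra_simps del: of_nat_Suc)
    also have "\<dots> = 1 / (2 * ?r) * s\<^sup>2 + ?r / 2"
    proof -
      have "(x + q\<^sup>2) / (2 * q) = 1 / (2 * q) * x + q / 2" if "0 < q" for q x :: real
        using that by (simp add: power2_eq_square add_divide_distrib)
      then show ?thesis using r(1) by blast
    qed
    finally show ?thesis .
  qed
  then have "walk_expect p v n (\<lambda>s. \<bar>s\<bar>) \<le> walk_expect p v n (\<lambda>s. 1 / (2 * ?r) * s\<^sup>2 + ?r / 2)"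
    by (rule walk_expect_mono)
  also have "\<dots> = 1 / (2 * ?r) * real n + ?r / 2"
    by (simp only: walk_expect_add walk_expect_cmult walk_expect_const walk_expect_square)
  also have "\<dots> \<le> 1 / (2 * ?r) * ?r\<^sup>2 + ?r / 2"
    unfolding r(2) by (intro add_right_mono mult_left_mono) simp_all
  also have "\<dots> = ?r"
  proof -
    have "1 / (2 * q) * q\<^sup>2 + q / 2 = q" if "0 < q" for q :: real
      using that by (simp add: power2_eq_square)
    then show ?thesis using r(1) by blast
  qed
  finally show ?thesis .
qed

text \<open>The walk has \<open>n\<close> steps but is normalised for \<open>n + 1\<close>. The
  ratio of the two scales is at most 2, and \<open>Phi\<close> is 1-Lipschitz, so the mismatch only
  doubles the length of the interval.\<close>

lemma walk_interval_prob_le: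
  assumes "1 \<le> n" and "a \<le> b"
    and kolmogorov: "\<And>z. \<bar>walk_expect p v n (\<lambda>s. of_bool (s \<le> sqrt (real n) * z)) - Phi z\<bar> \<le> \<delta>"
  defines "r \<equiv> sqrt (real (Suc n))"
  shows "walk_expect p v n (\<lambda>s. of_bool (a < s / r \<and> s / r \<le> b)) \<le> 2 * (b - a) + 2 * \<delta>"
proof -
  let ?q = "r / sqrt (real n)"
  have r: "0 < r" and n: "0 < sqrt (real n)"
    using assms(1) by (simp_all add: r_def)
  have "sqrt (real (Suc n)) \<le> sqrt (4 * real n)"
    using assms(1) by (intro real_sqrt_le_mono) simp
  then have q: "0 < ?q" "?q \<le> 2"
    using r n by (simp_all add: r_def real_sqrt_mult divide_le_eq)
  have iff: "s / r \<le> u \<longleftrightarrow> s \<le> sqrt (real n) * (?q * u)" for s u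
    using r n by (simp add: field_simps)
  have "of_bool (a < s / r \<and> s / r \<le> b)
      = (of_bool (s \<le> sqrt (real n) * (?q * b)) - of_bool (s \<le> sqrt (real n) * (?q * a)) :: real)" for s
    unfolding iff[symmetric] using assms(2) by (auto simp: of_bool_def)
  then have "walk_expect p v n (\<lambda>s. of_bool (a < s / r \<and> s / r \<le> b))
      = walk_expect p v n (\<lambda>s. of_bool (s \<le> sqrt (real n) * (?q * b)))
        - walk_expect p v n (\<lambda>s. of_bool (s \<le> sqrt (real n) * (?q * a)))"
    by (simp only: walk_expect_diff)
  also have "\<dots> \<le> Phi (?q * b) - Phi (?q * a) + 2 * \<delta>"
    using kolmogorov[of "?q * b"] kolmogorov[of "?q * a"] by linarith
  also have "Phi (?q * b) - Phi (?q * a) \<le> ?q * b - ?q * a"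
    using q assms(2) by (intro Phi_diff_le mult_left_mono) auto
  also have "\<dots> = ?q * (b - a)"
    by (simp add: right_diff_distrib)
  also have "\<dots> \<le> 2 * (b - a)"
    using q assms(2) by (intro mult_right_mono) auto
  finally show ?thesis by simp
qed

text \<open>The Stein equation leaves \<open>E f'(S / r) - E (S / r * f (S / r))\<close> for the
  longer walk. Exchangeability writes both terms as an \<open>n\<close>-step walk plus one further
  step, in which \<open>f\<close> and \<open>f'\<close> are expanded. The distribution of the
  \<open>n\<close>-step walk enters only through \<delta> and its first absolute moment.\<close>

lemma berry_esseen_ramp_step:
  assumes "1 \<le> n" and v_bound: "\<And>a. \<bar>v a\<bar> \<le> \<beta>" and "1 \<le> \<beta>" and "0 < l"
    and kolmogorov: "\<And>z. \<bar>walk_expect p v n (\<lambda>s. of_bool (s \<le> sqrt (real n) * z)) - Phi z\<bar> \<le> \<delta>"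
  defines "r \<equiv> sqrt (real (Suc n))"
  shows "\<bar>walk_expect p v (Suc n) (\<lambda>s. ramp z l (s / r)) - (LINT x|lborel. ramp z l x * std_normal_density x)\<bar>
    \<le> 2 * \<beta> ^ 3 / r * (8 + (2 * (l + 3 * (\<beta> / r)) + 2 * \<delta>) / l)"
proof -
  let ?E = "walk_expect p v"
  have r: "0 < r" "r\<^sup>2 = real (Suc n)" "1 \<le> r"
    by (simp_all add: r_def)
  define c where "c = (LINT x|lborel. ramp z l x * std_normal_density x)"
  obtain f where f': "\<And>w. (f has_real_derivative w * f w + ramp z l w - c) (at w)"
    and f6: "\<And>w. \<bar>f w\<bar> \<le> 6" and wf: "\<And>w. \<bar>w * f w\<bar> \<le> 1"
    using stein_equation[OF continuous_on_ramp ramp_nonneg ramp_le_1, of z l] unfolding c_def by blast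
  \<comment> \<open>\<open>D\<close> is the derivative of \<open>f\<close>, written through the
    Stein equation so that its increments can be estimated although the ramp has kinks.\<close>
  define D where "D w = w * f w + ramp z l w - c" for w
  have c01: "0 \<le> c" "c \<le> 1"
    using gaussian_ramp_bounds[OF \<open>0 < l\<close>, of z] Phi_nonneg[of z] Phi_le_1[of "z + l"] by (simp_all add: c_def)
  have D2: "\<bar>D w\<bar> \<le> 2" for w
    using wf[of w] ramp_nonneg[of z l w] ramp_le_1[of z l w] c01 unfolding D_def by linarith
  have mvt: "\<exists>\<xi>. \<bar>\<xi>\<bar> \<le> \<bar>t\<bar> \<and> f (w + t) - f w = t * D (w + \<xi>)" for w t
  proof (cases t "0 :: real" rule: linorder_cases)
    case greater
    then obtain y where "w < y" "y < w + t" "f (w + t) - f w = (w + t - w) * D y"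
      using MVT2[of w "w + t" f D] f' unfolding D_def by auto
    then show ?thesis using greater by (intro exI[of _ "y - w"]) auto
  next
    case less
    then obtain y where "w + t < y" "y < w" "f w - f (w + t) = (w - (w + t)) * D y"
      using MVT2[of "w + t" w f D] f' unfolding D_def by auto
    then show ?thesis using less by (intro exI[of _ "y - w"]) (auto simp: algebra_simps)
  qed auto
  define \<tau> where "\<tau> = \<beta> / r"
  have \<tau>: "0 < \<tau>"
    using r \<open>1 \<le> \<beta>\<close> by (simp add: \<tau>_def)
  \<comment> \<open>A local Lipschitz constant of \<open>D\<close>: 6 bounds \<open>f\<close>, 2
    bounds the derivative of \<open>f\<close>, and the last term comes from the ramp.\<close>
  define L where "L w = 6 + 2 * \<bar>w\<bar> + 1 / l * of_bool (z - 2 * \<tau> < w \<and> w \<le> z + l + \<tau>)" for w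
  have L0: "0 \<le> L w" for w
    using \<open>0 < l\<close> by (simp add: L_def)
  have f_lip: "\<bar>f (w + t) - f w\<bar> \<le> 2 * \<bar>t\<bar>" for w t
  proof -
    obtain \<xi> where "f (w + t) - f w = t * D (w + \<xi>)" using mvt by blast
    then show ?thesis
      using D2[of "w + \<xi>"] by (simp add: abs_mult mult.commute mult_left_mono)
  qed
  have D_lip: "\<bar>D (w + t) - D w\<bar> \<le> \<bar>t\<bar> * L w" if "\<bar>t\<bar> \<le> \<tau>" for w t
  proof -
    have "D (w + t) - D w = t * f (w + t) + w * (f (w + t) - f w) + (ramp z l (w + t) - ramp z l w)"
      by (simp add: D_def algebra_simps)
    also have "\<bar>\<dots>\<bar> \<le> \<bar>t * f (w + t)\<bar> + \<bar>w * (f (w + t) - f w)\<bar> + \<bar>ramp z l (w + t) - ramp z l w\<bar>"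
      by linarith
    also have "\<bar>t * f (w + t)\<bar> \<le> \<bar>t\<bar> * 6"
      using f6[of "w + t"] by (simp add: abs_mult mult_left_mono)
    also have "\<bar>w * (f (w + t) - f w)\<bar> \<le> \<bar>w\<bar> * (2 * \<bar>t\<bar>)"
      using f_lip[of w t] by (simp only: abs_mult) (intro mult_left_mono, auto)
    also have "\<bar>ramp z l (w + t) - ramp z l w\<bar>
        \<le> \<bar>t\<bar> / l * of_bool (z - 2 * \<tau> < w \<and> w \<le> z + l + \<tau>)"
      by (rule ramp_increment[OF \<open>0 < l\<close> \<tau> that])
    finally show ?thesis
      by (simp add: L_def algebra_simps)
  qed
  have taylor: "\<bar>f (w + t) - f w - t * D w\<bar> \<le> t\<^sup>2 * L w" if "\<bar>t\<bar> \<le> \<tau>" for w t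
  proof -
    obtain \<xi> where \<xi>: "\<bar>\<xi>\<bar> \<le> \<bar>t\<bar>" "f (w + t) - f w = t * D (w + \<xi>)" using mvt by blast
    have "f (w + t) - f w - t * D w = t * (D (w + \<xi>) - D w)"
      by (simp only: \<xi>(2) right_diff_distrib)
    then have "\<bar>f (w + t) - f w - t * D w\<bar> = \<bar>t\<bar> * \<bar>D (w + \<xi>) - D w\<bar>"
      by (simp add: abs_mult)
    also have "\<dots> \<le> \<bar>t\<bar> * (\<bar>\<xi>\<bar> * L w)"
      using \<xi>(1) that by (intro mult_left_mono D_lip) auto
    also have "\<dots> \<le> \<bar>t\<bar> * (\<bar>t\<bar> * L w)"
      using \<xi>(1) L0 by (intro mult_left_mono mult_right_mono) auto
    finally show ?thesis by (simp add: power2_eq_square flip: mult.assoc)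
  qed
  have t_bound: "\<bar>v a / r\<bar> \<le> \<tau>" for a
    using v_bound[of a] r by (simp add: \<tau>_def divide_right_mono)
  \<comment> \<open>The Taylor remainders of one step from \<open>s\<close>. The subtracted
    \<open>f (s / r)\<close> averages out by zero mean, and the two contributions of
    \<open>D (s / r)\<close> cancel by unit variance.\<close>
  define R where "R s = (\<Sum>a\<in>UNIV. p a * (D (s / r + v a / r) - D (s / r)
      - r * v a * (f (s / r + v a / r) - f (s / r) - v a / r * D (s / r))))" for s
  have "?E (Suc n) (\<lambda>s. ramp z l (s / r)) - c = ?E (Suc n) (\<lambda>s. ramp z l (s / r) - c)"
    by (simp only: walk_expect_diff walk_expect_const)
  also have "\<dots> = ?E (Suc n) (\<lambda>s. D (s / r) - 1 / r * (s * f (s / r)))"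
    by (simp add: D_def)
  also have "\<dots> = ?E (Suc n) (\<lambda>s. D (s / r)) - 1 / r * ?E (Suc n) (\<lambda>s. s * f (s / r))"
    by (simp only: walk_expect_diff walk_expect_cmult)
  also have "?E (Suc n) (\<lambda>s. s * f (s / r))
      = r\<^sup>2 * ?E n (\<lambda>s. \<Sum>a\<in>UNIV. p a * (v a * f ((s + v a) / r)))"
    unfolding r(2) by (rule walk_expect_times_self)
  also have "?E (Suc n) (\<lambda>s. D (s / r)) - 1 / r * (r\<^sup>2 * ?E n (\<lambda>s. \<Sum>a\<in>UNIV. p a * (v a * f ((s + v a) / r))))
      = ?E n (\<lambda>s. (\<Sum>a\<in>UNIV. p a * D ((s + v a) / r))
          - r * (\<Sum>a\<in>UNIV. p a * (v a * f ((s + v a) / r))))"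
    using r(1) by (simp add: walk_expect_diff walk_expect_cmult power2_eq_square[of r])
  also have "\<dots> = ?E n R"
  proof -
    have "R s = (\<Sum>a\<in>UNIV. p a * D ((s + v a) / r)) - r * (\<Sum>a\<in>UNIV. p a * (v a * f ((s + v a) / r)))" for s
    proof -
      have "R s = (\<Sum>a\<in>UNIV. p a * D ((s + v a) / r) - r * (p a * (v a * f ((s + v a) / r)))
          - p a * D (s / r) + p a * v a * (r * f (s / r)) + p a * (v a)\<^sup>2 * D (s / r))"
        unfolding R_def using r
        by (intro sum.cong refl) (simp add: add_divide_distrib algebra_simps power2_eq_square)
      also have "\<dots> = (\<Sum>a\<in>UNIV. p a * D ((s + v a) / r))
          - r * (\<Sum>a\<in>UNIV. p a * (v a * f ((s + v a) / r)))
          - (\<Sum>a\<in>UNIV. p a) * D (s / r) + (\<Sum>a\<in>UNIV. p a * v a) * (r * f (s / r))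
          + (\<Sum>a\<in>UNIV. p a * (v a)\<^sup>2) * D (s / r)"
        by (simp only: sum.distrib sum_subtractf sum_distrib_left sum_distrib_right)
      finally show ?thesis by (simp add: p_sum mean var)
    qed
    then show ?thesis by presburger
  qed
  finally have main: "?E (Suc n) (\<lambda>s. ramp z l (s / r)) - c = ?E n R" .
  have R_bound: "\<bar>R s\<bar> \<le> 2 * \<beta> ^ 3 / r * L (s / r)" for s
  proof -
    have "\<bar>D (s / r + v a / r) - D (s / r) - r * v a * (f (s / r + v a / r) - f (s / r) - v a / r * D (s / r))\<bar>
        \<le> 2 * \<beta> ^ 3 / r * L (s / r)" (is "\<bar>?x - ?y * ?z\<bar> \<le> _") for a
    proof -
      have "\<bar>?x\<bar> \<le> \<bar>v a / r\<bar> * L (s / r)"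
        by (rule D_lip[OF t_bound])
      also have "\<dots> \<le> \<tau> * L (s / r)"
        by (intro mult_right_mono t_bound L0)
      also have "\<dots> \<le> \<beta> ^ 3 / r * L (s / r)"
        unfolding \<tau>_def using \<open>1 \<le> \<beta>\<close> r L0
        by (intro mult_right_mono divide_right_mono self_le_power) auto
      finally have 1: "\<bar>?x\<bar> \<le> \<beta> ^ 3 / r * L (s / r)" .
      have "\<bar>?y * ?z\<bar> \<le> \<bar>?y\<bar> * ((v a / r)\<^sup>2 * L (s / r))"
        unfolding abs_mult[of ?y] by (intro mult_left_mono taylor t_bound) auto
      also have "\<dots> = \<bar>v a\<bar> ^ 3 / r * L (s / r)"
        unfolding power_divide power2_abs[of "v a", symmetric]
        using r(1) by (simp add: abs_mult power2_eq_square power3_eq_cube field_simps)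
      also have "\<dots> \<le> \<beta> ^ 3 / r * L (s / r)"
        using v_bound[of a] r L0 by (intro mult_right_mono divide_right_mono power_mono) auto
      finally have "\<bar>?x - ?y * ?z\<bar> \<le> \<beta> ^ 3 / r * L (s / r) + \<beta> ^ 3 / r * L (s / r)"
        by (intro order_trans[OF abs_triangle_ineq4] add_mono 1)
      then show ?thesis by (simp add: mult_ac)
    qed
    then have "\<bar>R s\<bar> \<le> (\<Sum>a\<in>UNIV. p a * (2 * \<beta> ^ 3 / r * L (s / r)))"
      unfolding R_def using p_nonneg
      by (intro order_trans[OF sum_abs] sum_mono) (simp only: abs_mult abs_of_nonneg mult_left_mono)
    also have "\<dots> = 2 * \<beta> ^ 3 / r * L (s / r)"
      by (simp only: sum_distrib_right[symmetric] p_sum mult_1_left)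
    finally show ?thesis .
  qed
  have "\<bar>?E n R\<bar> \<le> 2 * \<beta> ^ 3 / r * ?E n (\<lambda>s. L (s / r))"
    unfolding walk_expect_cmult[symmetric] by (intro walk_expect_abs_le R_bound)
  also have "?E n (\<lambda>s. L (s / r)) \<le> 8 + (2 * (l + 3 * \<tau>) + 2 * \<delta>) / l"
  proof -
    have "?E n (\<lambda>s. L (s / r)) = ?E n (\<lambda>s. 6 + 2 / r * \<bar>s\<bar>
        + 1 / l * of_bool (z - 2 * \<tau> < s / r \<and> s / r \<le> z + l + \<tau>))"
      using r by (simp add: L_def)
    also have "\<dots> = 6 + 2 / r * ?E n (\<lambda>s. \<bar>s\<bar>)
        + 1 / l * ?E n (\<lambda>s. of_bool (z - 2 * \<tau> < s / r \<and> s / r \<le> z + l + \<tau>))"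
      by (simp only: walk_expect_add walk_expect_cmult walk_expect_const)
    also have "\<dots> \<le> 6 + 2 / r * r + 1 / l * (2 * ((z + l + \<tau>) - (z - 2 * \<tau>)) + 2 * \<delta>)"
    proof (intro add_mono mult_left_mono order_refl)
      show "?E n (\<lambda>s. \<bar>s\<bar>) \<le> r"
        unfolding r_def by (rule walk_expect_abs_le_sqrt)
      show "?E n (\<lambda>s. of_bool (z - 2 * \<tau> < s / r \<and> s / r \<le> z + l + \<tau>))
          \<le> 2 * ((z + l + \<tau>) - (z - 2 * \<tau>)) + 2 * \<delta>"
        unfolding r_def using \<open>0 < l\<close> \<tau>
        by (intro walk_interval_prob_le \<open>1 \<le> n\<close> kolmogorov) simp
    qed (use r \<open>0 < l\<close> in auto)
    also have "\<dots> = 8 + (2 * (l + 3 * \<tau>) + 2 * \<delta>) / l"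
      using r by (simp add: algebra_simps add_divide_distrib)
    finally show ?thesis .
  qed
  finally show ?thesis
    using r \<open>1 \<le> \<beta>\<close> unfolding main[symmetric] c_def \<tau>_def
    by (simp add: mult_left_mono divide_right_mono)
qed

text \<open>The smoothing width is chosen so that the error of the previous step enters with a factor
  smaller than one (Bolthausen's induction).\<close>

theorem berry_esseen:
  "\<exists>K. \<forall>n\<ge>1. \<forall>z. \<bar>walk_expect p v n (\<lambda>s. of_bool (s \<le> sqrt (real n) * z)) - Phi z\<bar> \<le> K / sqrt (real n)"
proof -
  let ?E = "walk_expect p v"
  define \<beta> where "\<beta> = 1 + (\<Sum>a\<in>UNIV. \<bar>v a\<bar>)"
  have \<beta>1: "1 \<le> \<beta>"
    by (simp add: \<beta>_def sum_nonneg)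
  have v_bound: "\<bar>v a\<bar> \<le> \<beta>" for a
    using member_le_sum[of a UNIV "\<lambda>a. \<bar>v a\<bar>"] by (simp add: \<beta>_def)
  \<comment> \<open>Replacing \<open>sqrt n\<close> by \<open>sqrt (Suc n)\<close> costs at most
    3/2, so the factor 1/2 of the previous error becomes 3/4. The other errors total
    \<open>30 * \<beta> ^ 3 / r\<close>, and \<open>K\<close> solves
    \<open>30 * \<beta> ^ 3 + 3 / 4 * K = K\<close>.\<close>
  define K where "K = 120 * \<beta> ^ 3"
  have \<beta>3: "1 \<le> \<beta> ^ 3"
    using \<beta>1 by (rule one_le_power)
  have "\<bar>?E n (\<lambda>s. of_bool (s \<le> sqrt (real n) * z)) - Phi z\<bar> \<le> K / sqrt (real n)" if "1 \<le> n" for n z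
    using that
  proof (induction n arbitrary: z rule: dec_induct)
    case base
    have "?E 1 (\<lambda>s. of_bool (s \<le> sqrt (real 1) * z)) \<le> ?E 1 (\<lambda>_. 1)"
      and "?E 1 (\<lambda>_. 0) \<le> ?E 1 (\<lambda>s. of_bool (s \<le> sqrt (real 1) * z))"
      by (rule walk_expect_mono; simp)+
    then have "\<bar>?E 1 (\<lambda>s. of_bool (s \<le> sqrt (real 1) * z)) - Phi z\<bar> \<le> 1"
      unfolding walk_expect_const using Phi_nonneg[of z] Phi_le_1[of z] by linarith
    also have "1 \<le> K / sqrt (real 1)"
      using \<beta>3 by (simp add: K_def)
    finally show ?case .
  next
    case (step n)
    define r where "r = sqrt (real (Suc n))"
    \<comment> \<open>This makes the coefficient \<open>4 * \<beta> ^ 3 / (r * l)\<close> of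
      \<delta> in \<open>e\<close> equal to 1/2.\<close>
    define l where "l = 8 * \<beta> ^ 3 / r"
    define \<delta> where "\<delta> = K / sqrt (real n)"
    have r: "0 < r" by (simp add: r_def)
    have l: "0 < l"
      using r \<beta>1 by (simp add: l_def)
    define e where "e = 2 * \<beta> ^ 3 / r * (8 + (2 * (l + 3 * (\<beta> / r)) + 2 * \<delta>) / l)"
    have ramp: "\<bar>?E (Suc n) (\<lambda>s. ramp z l (s / r)) - (LINT x|lborel. ramp z l x * std_normal_density x)\<bar> \<le> e" for z
      unfolding e_def r_def
      by (intro berry_esseen_ramp_step[OF step(1) v_bound \<beta>1 l]) (use step(3) in \<open>simp add: \<delta>_def\<close>)
    have upper: "?E (Suc n) (\<lambda>s. of_bool (s \<le> r * z)) \<le> Phi z + l + e"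
    proof -
      have "?E (Suc n) (\<lambda>s. of_bool (s \<le> r * z)) \<le> ?E (Suc n) (\<lambda>s. ramp z l (s / r))"
      proof (rule walk_expect_mono)
        show "of_bool (s \<le> r * z) \<le> ramp z l (s / r)" for s
          using r by (cases "s \<le> r * z") (simp_all add: ramp_nonneg ramp_eq_1[OF l] pos_divide_le_eq mult.commute)
      qed
      then show ?thesis
        using ramp[of z] gaussian_ramp_bounds(2)[OF l, of z] Phi_diff_le[of z "z + l"] l by linarith
    qed
    \<comment> \<open>The ramp must now lie below the indicator, so it falls from
      \<open>z - l\<close> to \<open>z\<close>.\<close>
    have lower: "Phi z - l - e \<le> ?E (Suc n) (\<lambda>s. of_bool (s \<le> r * z))"
    proof -
      have "?E (Suc n) (\<lambda>s. ramp (z - l) l (s / r)) \<le> ?E (Suc n) (\<lambda>s. of_bool (s \<le> r * z))"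
      proof (rule walk_expect_mono)
        show "ramp (z - l) l (s / r) \<le> of_bool (s \<le> r * z)" for s
          using r ramp_eq_0[OF l, of "z - l" "s / r"]
          by (cases "s \<le> r * z") (simp_all add: ramp_le_1 pos_le_divide_eq mult.commute)
      qed
      then show ?thesis
        using ramp[of "z - l"] gaussian_ramp_bounds(1)[OF l, of "z - l"] Phi_diff_le[of "z - l" z] l by linarith
    qed
    have "e = 2 * \<beta> ^ 3 / r * (10 + 6 * \<beta> / (r * l)) + 4 * \<beta> ^ 3 / (r * l) * \<delta>"
      unfolding e_def using r l by (simp add: field_simps)
    also have "r * l = 8 * \<beta> ^ 3"
      using r by (simp add: l_def)
    also have "4 * \<beta> ^ 3 / (8 * \<beta> ^ 3) * \<delta> = \<delta> / 2"
      using \<beta>1 by simp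
    also have "2 * \<beta> ^ 3 / r * (10 + 6 * \<beta> / (8 * \<beta> ^ 3)) \<le> 2 * \<beta> ^ 3 / r * 11"
    proof -
      have "\<beta> \<le> \<beta> ^ 3"
        using \<beta>1 by (intro self_le_power) auto
      then have "6 * \<beta> / (8 * \<beta> ^ 3) \<le> 1"
        using \<beta>1 by (simp add: divide_le_eq)
      then show ?thesis
        using r \<beta>1 by (intro mult_left_mono divide_nonneg_pos) auto
    qed
    finally have e: "e \<le> 22 * \<beta> ^ 3 / r + \<delta> / 2" by simp
    have "\<delta> \<le> 3 / 2 * K / r"
    proof -
      have "r \<le> sqrt ((3 / 2)\<^sup>2 * real n)"
        unfolding r_def using step(1) by (intro real_sqrt_le_mono) (simp add: power2_eq_square)
      then have "r \<le> 3 / 2 * sqrt (real n)"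
        by (simp add: real_sqrt_mult)
      moreover have "0 < K" using \<beta>1 by (simp add: K_def)
      moreover have "0 < sqrt (real n)" using step(1) by simp
      ultimately show ?thesis
        using r by (simp add: \<delta>_def field_simps)
    qed
    with e have "l + e \<le> 30 * \<beta> ^ 3 / r + 3 / 4 * K / r"
      by (simp add: l_def)
    also have "\<dots> = K / r"
      using r by (simp add: K_def field_simps)
    finally show ?case
      using upper lower unfolding r_def by linarith
  qed
  then show ?thesis by blast
qed

end

end

section \<open>The converse for singular symmetric channels\<close>

text \<open>The reference output law with which every code is compared.\<close>

definition uniform_out :: "('x::finite \<Rightarrow> 'y::finite \<Rightarrow> real) \<Rightarrow> 'y \<Rightarrow> real" where
  "uniform_out W y = (\<Sum>x\<in>UNIV. W x y) / real CARD('x)"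

text \<open>For a singular channel this is \<open>ln (W x y / uniform_out W y)\<close> whenever \<open>W x y > 0\<close>. An output
  that no input can produce gets the junk value \<open>0\<close>, but also has probability \<open>0\<close>.\<close>

definition letter_info :: "('x::finite \<Rightarrow> 'y::finite \<Rightarrow> real) \<Rightarrow> 'y \<Rightarrow> real" where
  "letter_info W y = ln (real CARD('x) / real (card {x. 0 < W x y}))"

text \<open>Nonnegativity of relative entropy, kept termwise so that equality of the sums forces
  equality of the laws. It comes from \<open>ln x \<le> x - 1\<close>, with equality only at
  1.\<close>

lemma gibbs_term:
  fixes a b :: real
  assumes "0 \<le> a" and "0 \<le> b" and "b = 0 \<Longrightarrow> a = 0"
  shows "a - b \<le> a * ln (a / b)" and "a * ln (a / b) = a - b \<Longrightarrow> a = b"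
proof -
  have pos: "0 < b / a \<and> a * ln (a / b) = - a * ln (b / a)" if "a \<noteq> 0"
    using that assms by (cases "b = 0") (auto simp: ln_div algebra_simps)
  show "a - b \<le> a * ln (a / b)"
  proof (cases "a = 0")
    case False
    then have "a * ln (b / a) \<le> a * (b / a - 1)"
      using pos assms by (intro mult_left_mono ln_le_minus_one) auto
    then show ?thesis
      using pos False by (simp add: right_diff_distrib)
  qed (use assms in simp)
  show "a = b" if "a * ln (a / b) = a - b"
  proof (cases "a = 0")
    case False
    then have "a * ln (b / a) = a * (b / a - 1)"
      using pos that by (simp add: right_diff_distrib)
    then have "ln (b / a) = b / a - 1"
      using False by simp
    then have "b / a = 1"
      using pos False by (intro ln_eq_minus_one) auto
    then show ?thesis using False by simp
  qed (use that in simp)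
qed

lemma sum_lists_Suc:
  fixes g :: "'y::finite list \<Rightarrow> real"
  shows "(\<Sum>ys\<in>{ys. length ys = Suc n}. g ys) = (\<Sum>ys\<in>{ys. length ys = n}. \<Sum>y\<in>UNIV. g (ys @ [y]))"
proof -
  have "(\<Sum>ys\<in>{ys. length ys = Suc n}. g ys) = (\<Sum>(ys, y)\<in>{ys. length ys = n} \<times> UNIV. g (ys @ [y]))"
    by (rule sum.reindex_bij_witness[of _ "\<lambda>(ys, y). ys @ [y]" "\<lambda>zs. (butlast zs, last zs)"])
       (auto simp: append_butlast_last_id length_Suc_conv_rev)
  then show ?thesis
    by (simp add: sum.cartesian_product)
qed

lemma fb_out_prob_append:
  assumes "length ys = N"
  shows "fb_out_prob W (Suc N) f m (ys @ [y]) = fb_out_prob W N f m ys * W (f N m ys) y"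
  using assms by (simp add: fb_out_prob_def nth_append)

text \<open>If the law of \<open>v\<close> under an output does not depend on the input, then feedback cannot
  influence the law of the accumulated \<open>v\<close>.\<close>

lemma feedback_walk_expect:
  fixes U :: "'x::finite \<Rightarrow> 'y::finite \<Rightarrow> real"
  assumes "\<And>x \<psi>. (\<Sum>y\<in>UNIV. U x y * \<psi> (v y)) = (\<Sum>y\<in>UNIV. q y * \<psi> (v y))"
  shows "(\<Sum>ys\<in>{ys. length ys = N}. fb_out_prob U N f m ys * \<psi> (sum_list (map v ys))) = walk_expect q v N \<psi>"
proof (induction N arbitrary: \<psi>)
  case 0
  then show ?case by (simp add: fb_out_prob_def)
next
  case (Suc N)
  have "(\<Sum>ys\<in>{ys. length ys = Suc N}. fb_out_prob U (Suc N) f m ys * \<psi> (sum_list (map v ys)))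
      = (\<Sum>ys\<in>{ys. length ys = N}. fb_out_prob U N f m ys *
          (\<Sum>y\<in>UNIV. U (f N m ys) y * \<psi> (sum_list (map v ys) + v y)))"
    unfolding sum_lists_Suc sum_distrib_left
    by (intro sum.cong refl) (simp add: fb_out_prob_append algebra_simps)
  \<comment> \<open>The next input depends on the message and the past, but the hypothesis, applied
    to \<psi> shifted by the accumulated sum, makes it irrelevant.\<close>
  also have "\<dots> = (\<Sum>ys\<in>{ys. length ys = N}. fb_out_prob U N f m ys *
          (\<Sum>y\<in>UNIV. q y * \<psi> (sum_list (map v ys) + v y)))"
    using assms[of _ "\<lambda>t. \<psi> (_ + t)"] by simp
  also have "\<dots> = walk_expect q v (Suc N) \<psi>"
    using Suc[of "\<lambda>s. \<Sum>y\<in>UNIV. q y * \<psi> (s + v y)"] by simp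
  finally show ?case .
qed

context
  fixes W :: "'x::finite \<Rightarrow> 'y::finite \<Rightarrow> real"
  assumes channel: "channel W"
begin

lemma channel_nonneg: "0 \<le> W x y"
  and channel_sum: "(\<Sum>y\<in>UNIV. W x y) = 1"
  using channel by (auto simp: channel_def)

lemma uniform_out_nonneg: "0 \<le> uniform_out W y"
  by (simp add: uniform_out_def sum_nonneg channel_nonneg)

lemma uniform_out_sum: "(\<Sum>y\<in>UNIV. uniform_out W y) = 1"
  unfolding uniform_out_def sum_divide_distrib[symmetric]
  by (subst sum.swap) (simp add: channel_sum)

lemma uniform_out_eq_0: "uniform_out W y = 0 \<Longrightarrow> W x y = 0"
  by (simp add: uniform_out_def channel_nonneg sum_nonneg_eq_0_iff)

lemma out_dist_uniform: "out_dist (\<lambda>_. 1 / real CARD('x)) W = uniform_out W"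
  by (auto simp: out_dist_def uniform_out_def sum_divide_distrib)

context
  assumes singular: "singular_channel W"
begin

text \<open>By singularity column \<open>y\<close> is constant on its support, so its average is
  \<open>W x y\<close> times the fraction of inputs in the support. The factor
  \<open>exp (letter_info W y)\<close> is the inverse of that fraction.\<close>

lemma channel_eq_letter_info:
  assumes "0 < W x y"
  shows "W x y = uniform_out W y * exp (letter_info W y)"
proof -
  have "(\<Sum>z\<in>UNIV. W z y) = (\<Sum>z\<in>{z. 0 < W z y}. W z y)"
    using channel_nonneg by (intro sum.mono_neutral_right) (auto simp: less_le)
  also have "\<dots> = (\<Sum>z\<in>{z. 0 < W z y}. W x y)"
    using singular assms unfolding singular_channel_def by (intro sum.cong refl) force
  finally have "(\<Sum>z\<in>UNIV. W z y) = real (card {z. 0 < W z y}) * W x y" by simp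
  then have sum: "uniform_out W y = real (card {z. 0 < W z y}) * W x y / real CARD('x)"
    by (simp add: uniform_out_def)
  have "0 < card {z. 0 < W z y}"
    using assms by (auto simp: card_gt_0_iff)
  then show ?thesis
    unfolding sum letter_info_def by (subst exp_ln) auto
qed

lemma channel_le_letter_info: "W x y \<le> uniform_out W y * exp (letter_info W y)"
  using channel_eq_letter_info[of x y] channel_nonneg[of x y] uniform_out_nonneg[of y]
  by (cases "0 < W x y") auto

text \<open>A change of measure whose right side involves neither the message nor the encoder, so it
  can be summed over disjoint decoding regions.\<close>

lemma fb_out_prob_le:
  "fb_out_prob W N f m ys \<le> (\<Prod>i<N. uniform_out W (ys ! i)) * exp (\<Sum>i<N. letter_info W (ys ! i))"
proof -
  have "fb_out_prob W N f m ys \<le> (\<Prod>i<N. uniform_out W (ys ! i) * exp (letter_info W (ys ! i)))"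
    unfolding fb_out_prob_def by (intro prod_mono conjI channel_nonneg channel_le_letter_info)
  then show ?thesis
    by (simp add: prod.distrib exp_sum)
qed

context
  assumes symmetric: "symmetric_channel W"
begin

text \<open>Within a block, permuted columns have supports of equal size, so
  \<open>letter_info\<close> is constant there; permuted rows give the block the same mass under
  every input. Averaging over inputs brings in \<open>uniform_out\<close>.\<close>

lemma letter_info_law:
  "(\<Sum>y\<in>UNIV. W x y * \<psi> (letter_info W y)) = (\<Sum>y\<in>UNIV. uniform_out W y * \<psi> (letter_info W y))"
proof -
  obtain Ps where Ps: "partition_on (UNIV::'y set) Ps"
    and rows: "\<And>B x x'. B \<in> Ps \<Longrightarrow> \<exists>\<sigma>. bij_betw \<sigma> B B \<and> (\<forall>y\<in>B. W x' y = W x (\<sigma> y))"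
    and cols: "\<And>B y y'. B \<in> Ps \<Longrightarrow> y \<in> B \<Longrightarrow> y' \<in> B \<Longrightarrow> \<exists>\<tau>::'x \<Rightarrow> 'x. bij \<tau> \<and> (\<forall>x. W x y' = W (\<tau> x) y)"
    using symmetric unfolding symmetric_channel_def by metis
  have info: "letter_info W y' = letter_info W y" if B: "B \<in> Ps" "y \<in> B" "y' \<in> B" for B y y'
  proof -
    obtain \<tau> :: "'x \<Rightarrow> 'x" where \<tau>: "bij \<tau>" "\<And>x. W x y' = W (\<tau> x) y" using cols[OF B] by auto
    have "card {x. 0 < W x y'} = card (\<tau> -` {x. 0 < W x y})"
      by (simp add: \<tau>(2) vimage_def)
    also have "\<dots> = card {x. 0 < W x y}"
      using \<tau>(1) by (intro card_vimage_inj) (auto simp: bij_def)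
    finally show ?thesis by (simp add: letter_info_def)
  qed
  have split: "sum g UNIV = (\<Sum>B\<in>Ps. sum g B)" for g :: "'y \<Rightarrow> real"
  proof -
    have "sum g (\<Union>Ps) = (\<Sum>B\<in>Ps. sum g B)"
      using Ps by (subst sum.Union_disjoint) (auto simp: partition_on_def disjoint_def)
    then show ?thesis using Ps by (simp add: partition_on_def)
  qed
  have indep: "(\<Sum>y\<in>UNIV. W x' y * \<psi> (letter_info W y)) = (\<Sum>y\<in>UNIV. W x y * \<psi> (letter_info W y))" for x'
    unfolding split
  proof (rule sum.cong[OF refl])
    fix B assume B: "B \<in> Ps"
    obtain \<sigma> where \<sigma>: "bij_betw \<sigma> B B" "\<And>y. y \<in> B \<Longrightarrow> W x' y = W x (\<sigma> y)" using rows[OF B] by blast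
    have "(\<Sum>y\<in>B. W x' y * \<psi> (letter_info W y)) = (\<Sum>y\<in>B. W x (\<sigma> y) * \<psi> (letter_info W (\<sigma> y)))"
      using \<sigma> info[OF B] bij_betwE[OF \<sigma>(1)] by (intro sum.cong refl) metis
    also have "\<dots> = (\<Sum>y\<in>B. W x y * \<psi> (letter_info W y))"
      by (rule sum.reindex_bij_betw[OF \<sigma>(1)])
    finally show "(\<Sum>y\<in>B. W x' y * \<psi> (letter_info W y)) = (\<Sum>y\<in>B. W x y * \<psi> (letter_info W y))" .
  qed
  have "(\<Sum>y\<in>UNIV. uniform_out W y * \<psi> (letter_info W y))
      = (\<Sum>y\<in>UNIV. \<Sum>x'\<in>UNIV. W x' y * \<psi> (letter_info W y)) / real CARD('x)"
    by (simp add: uniform_out_def sum_divide_distrib sum_distrib_right)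
  also have "\<dots> = (\<Sum>x'\<in>(UNIV :: 'x set). \<Sum>y\<in>UNIV. W x' y * \<psi> (letter_info W y)) / real CARD('x)"
    by (subst sum.swap) simp
  also have "(\<Sum>x'\<in>(UNIV :: 'x set). \<Sum>y\<in>UNIV. W x' y * \<psi> (letter_info W y))
      = (\<Sum>x'\<in>(UNIV :: 'x set). \<Sum>y\<in>UNIV. W x y * \<psi> (letter_info W y))"
    by (rule sum.cong[OF refl indep])
  finally show ?thesis by simp
qed

text \<open>A sequence with accumulated information \<open>s \<ge> ln M\<close> is counted with its probability averaged over
  the messages. Any other sequence is correctly decoded for one message only, for which its
  probability is at most \<open>exp s\<close> times the one under uniform inputs.\<close>

lemma feedback_converse:
  assumes "1 \<le> M" and "fb_avg_error W N M f dec \<le> \<epsilon>"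
  shows "walk_expect (uniform_out W) (letter_info W) N (\<lambda>s. 1 - min 1 (exp (s - ln (real M)))) \<le> \<epsilon>"
proof -
  let ?E = "walk_expect (uniform_out W) (letter_info W) N"
  let ?Y = "{ys :: 'y list. length ys = N}"
  let ?P = "fb_out_prob W N f"
  define S where "S ys = sum_list (map (letter_info W) ys)" for ys :: "'y list"
  define Q where "Q ys = (\<Prod>i<N. uniform_out W (ys ! i))" for ys
  \<comment> \<open>The split is chosen so that
    \<open>min 1 (exp s / M) = hi s + lo s / M\<close>.\<close>
  define hi where "hi s = (of_bool (ln (real M) \<le> s) :: real)" for s
  define lo where "lo s = exp s * (1 - hi s)" for s
  have M: "0 < real M" using assms(1) by simp
  have hi01: "0 \<le> hi s" "hi s \<le> 1" for s by (simp_all add: hi_def)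
  have fin: "finite ?Y"
    using finite_lists_length_eq[of "UNIV :: 'y set" N] by simp
  have Wlaw: "(\<Sum>ys\<in>?Y. ?P m ys * \<psi> (S ys)) = ?E \<psi>" for m \<psi>
    unfolding S_def by (rule feedback_walk_expect[OF letter_info_law])
  \<comment> \<open>The product law \<open>Q\<close> is the output law of a channel that ignores its
    input, so the feedback lemma covers it too.\<close>
  have Qlaw: "(\<Sum>ys\<in>?Y. Q ys * \<psi> (S ys)) = ?E \<psi>" for \<psi>
    using feedback_walk_expect[of "\<lambda>(_::'x) y. uniform_out W y" "letter_info W" "uniform_out W" N f m \<psi> for m]
    by (simp add: S_def Q_def fb_out_prob_def)
  have one: "?E (\<lambda>_. c) = c" for c
    by (rule walk_expect_const[OF uniform_out_nonneg uniform_out_sum])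
  have P0: "0 \<le> ?P m ys" for m ys
    by (simp add: fb_out_prob_def prod_nonneg channel_nonneg)
  have Q0: "0 \<le> Q ys" for ys
    by (simp add: Q_def prod_nonneg uniform_out_nonneg)
  have PQ: "?P m ys \<le> Q ys * exp (S ys)" if "ys \<in> ?Y" for m ys
    using fb_out_prob_le[of N f m ys] that
    by (simp add: Q_def S_def sum_list_sum_nth atLeast0LessThan)
  have ptw: "of_bool (dec ys = m) * ?P m ys \<le> ?P m ys * hi (S ys) + of_bool (dec ys = m) * (Q ys * lo (S ys))"
    if "ys \<in> ?Y" for m ys
  proof (cases "ln (real M) \<le> S ys")
    case True
    then show ?thesis using P0[of m ys] by (simp add: hi_def lo_def)
  next
    case False
    then show ?thesis using PQ[OF that, of m] by (simp add: hi_def lo_def)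
  qed
  have "(\<Sum>m\<in>{1..M}. \<Sum>ys\<in>?Y. of_bool (dec ys = m) * ?P m ys)
      \<le> (\<Sum>m\<in>{1..M}. \<Sum>ys\<in>?Y. ?P m ys * hi (S ys) + of_bool (dec ys = m) * (Q ys * lo (S ys)))"
    by (intro sum_mono ptw)
  also have "\<dots> = real M * ?E hi + (\<Sum>m\<in>{1..M}. \<Sum>ys\<in>?Y. of_bool (dec ys = m) * (Q ys * lo (S ys)))"
    by (simp add: sum.distrib Wlaw)
  also have "(\<Sum>m\<in>{1..M}. \<Sum>ys\<in>?Y. of_bool (dec ys = m) * (Q ys * lo (S ys)))
      = (\<Sum>ys\<in>?Y. (\<Sum>m\<in>{1..M}. of_bool (dec ys = m)) * (Q ys * lo (S ys)))"
    by (subst sum.swap) (simp add: sum_distrib_right)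
  also have "\<dots> \<le> (\<Sum>ys\<in>?Y. 1 * (Q ys * lo (S ys)))"
  proof (intro sum_mono mult_right_mono)
    fix ys :: "'y list"
    have "(\<Sum>m\<in>{1..M}. of_bool (dec ys = m)) = (\<Sum>m\<in>{1..M}. if dec ys = m then 1 else (0::real))"
      by (intro sum.cong) auto
    then show "(\<Sum>m\<in>{1..M}. of_bool (dec ys = m)) \<le> (1::real)"
      by simp
    show "0 \<le> Q ys * lo (S ys)"
      using Q0 hi01 by (simp add: lo_def)
  qed
  also have "\<dots> = ?E lo"
    by (simp add: Qlaw)
  finally have correct: "(\<Sum>m\<in>{1..M}. \<Sum>ys\<in>?Y. of_bool (dec ys = m) * ?P m ys) \<le> real M * ?E hi + ?E lo"
    by simp
  have "real M * fb_avg_error W N M f dec = (\<Sum>m\<in>{1..M}. \<Sum>ys\<in>?Y. ?P m ys * 1 - of_bool (dec ys = m) * ?P m ys)"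
    using M unfolding fb_avg_error_def by (auto intro!: sum.cong)
  also have "\<dots> = real M - (\<Sum>m\<in>{1..M}. \<Sum>ys\<in>?Y. of_bool (dec ys = m) * ?P m ys)"
    unfolding sum_subtractf using Wlaw[of _ "\<lambda>_. 1"] by (simp add: one)
  finally have error: "real M - (real M * ?E hi + ?E lo) \<le> real M * \<epsilon>"
    using correct mult_left_mono[OF assms(2), of "real M"] by simp
  have "?E (\<lambda>s. 1 - min 1 (exp (s - ln (real M)))) = 1 - (?E hi + 1 / real M * ?E lo)"
  proof -
    have "min 1 (exp (s - ln (real M))) = hi s + 1 / real M * lo s" for s
    proof (cases "ln (real M) \<le> s")
      case True
      then show ?thesis by (simp add: hi_def lo_def min_absorb1)
    next
      case False
      then have "min 1 (exp (s - ln (real M))) = exp (s - ln (real M))"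
        by (intro min_absorb2) simp
      also have "\<dots> = exp s / real M"
        using M by (simp add: exp_diff)
      also have "\<dots> = hi s + 1 / real M * lo s"
        using False by (simp add: hi_def lo_def)
      finally show ?thesis .
    qed
    then show ?thesis
      by (simp only: walk_expect_diff walk_expect_add walk_expect_cmult one)
  qed
  also have "\<dots> = (real M - (real M * ?E hi + ?E lo)) / real M"
    using M by (simp add: field_simps)
  also have "\<dots> \<le> \<epsilon>"
    using M error by (simp add: pos_divide_le_eq mult.commute)
  finally show ?thesis .
qed

section \<open>Capacity and dispersion\<close>

definition info_mean :: real where
  "info_mean = (\<Sum>y\<in>UNIV. uniform_out W y * letter_info W y)"

definition info_var :: real where
  "info_var = (\<Sum>y\<in>UNIV. uniform_out W y * (letter_info W y - info_mean)\<^sup>2)"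

lemma ln_channel_out_dist:
  assumes "0 < W x y" and "0 < r"
  shows "ln (W x y / r) = letter_info W y - ln (r / uniform_out W y)"
proof -
  have "uniform_out W y > 0"
    using uniform_out_nonneg[of y] uniform_out_eq_0[of y x] assms(1) by fastforce
  then show ?thesis
    using assms(2) by (simp add: channel_eq_letter_info[OF assms(1)] ln_div ln_mult)
qed

text \<open>The subtracted sum is the relative entropy of the output law from
  \<open>uniform_out\<close>, so maximising mutual information means minimising this
  divergence.\<close>

lemma mutual_info_eq:
  assumes P: "P \<in> input_dists"
  shows "mutual_info P W = info_mean
    - (\<Sum>y\<in>UNIV. out_dist P W y * ln (out_dist P W y / uniform_out W y))"
proof -
  have P0: "0 \<le> P x" and P1: "(\<Sum>x\<in>UNIV. P x) = 1" for x
    using P by (auto simp: input_dists_def)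
  let ?d = "\<lambda>y. ln (out_dist P W y / uniform_out W y)"
  have "P x * W x y * ln (W x y / out_dist P W y) = P x * (W x y * letter_info W y) - P x * W x y * ?d y" for x y
  proof (cases "P x * W x y = 0")
    case False
    then have "0 < P x * W x y" "0 < W x y"
      using P0[of x] channel_nonneg[of x y] by (auto simp: less_le)
    moreover have "P x * W x y \<le> out_dist P W y"
      unfolding out_dist_def using P0 channel_nonneg by (intro member_le_sum) auto
    ultimately show ?thesis
      using ln_channel_out_dist[of x y "out_dist P W y"] by (simp add: right_diff_distrib)
  qed auto
  then have "mutual_info P W = (\<Sum>x\<in>UNIV. P x * (\<Sum>y\<in>UNIV. W x y * letter_info W y))
      - (\<Sum>x\<in>UNIV. \<Sum>y\<in>UNIV. P x * W x y * ?d y)"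
    by (simp add: mutual_info_def sum_subtractf sum_distrib_left)
  also have "(\<Sum>x\<in>UNIV. P x * (\<Sum>y\<in>UNIV. W x y * letter_info W y)) = info_mean"
    using letter_info_law[of _ "\<lambda>t. t"] P1 by (simp add: info_mean_def flip: sum_distrib_right)
  also have "(\<Sum>x\<in>UNIV. \<Sum>y\<in>UNIV. P x * W x y * ?d y) = (\<Sum>y\<in>UNIV. out_dist P W y * ?d y)"
    by (subst sum.swap) (simp add: out_dist_def sum_distrib_right)
  finally show ?thesis .
qed

lemma mutual_info_le:
  assumes P: "P \<in> input_dists"
  shows "mutual_info P W \<le> info_mean"
    and "mutual_info P W = info_mean \<Longrightarrow> out_dist P W = uniform_out W"
proof -
  have P0: "0 \<le> P x" and P1: "(\<Sum>x\<in>UNIV. P x) = 1" for x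
    using P by (auto simp: input_dists_def)
  let ?q = "uniform_out W" and ?r = "out_dist P W"
  have r0: "0 \<le> ?r y" for y
    by (simp add: out_dist_def sum_nonneg P0 channel_nonneg)
  have rq: "?q y = 0 \<Longrightarrow> ?r y = 0" for y
    by (simp add: out_dist_def uniform_out_eq_0)
  have r1: "(\<Sum>y\<in>UNIV. ?r y) = 1"
    unfolding out_dist_def
    by (subst sum.swap) (simp add: channel_sum P1 flip: sum_distrib_left)
  let ?g = "\<lambda>y. ?r y * ln (?r y / ?q y) - (?r y - ?q y)"
  have g0: "0 \<le> ?g y" for y
    using gibbs_term(1)[OF r0 uniform_out_nonneg rq, of y] by simp
  have I: "mutual_info P W = info_mean - (\<Sum>y\<in>UNIV. ?g y)"
    by (simp add: mutual_info_eq[OF P] sum_subtractf r1 uniform_out_sum)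
  show "mutual_info P W \<le> info_mean"
    using I sum_nonneg[of UNIV ?g] g0 by simp
  assume "mutual_info P W = info_mean"
  then have "(\<Sum>y\<in>UNIV. ?g y) = 0" using I by simp
  then have "?g y = 0" for y
    using g0 by (subst (asm) sum_nonneg_eq_0_iff) auto
  then show "?r = ?q"
    using gibbs_term(2)[OF r0 uniform_out_nonneg rq] by (intro ext) simp
qed

lemma uniform_input_dist: "(\<lambda>_. 1 / real CARD('x)) \<in> (input_dists :: ('x \<Rightarrow> real) set)"
  by (simp add: input_dists_def)

lemma mutual_info_uniform: "mutual_info (\<lambda>_. 1 / real CARD('x)) W = info_mean"
  unfolding mutual_info_eq[OF uniform_input_dist] out_dist_uniform
proof -
  have "uniform_out W y * ln (uniform_out W y / uniform_out W y) = 0" for y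
    by (cases "uniform_out W y = 0") auto
  then show "info_mean - (\<Sum>y\<in>UNIV. uniform_out W y * ln (uniform_out W y / uniform_out W y)) = info_mean"
    by (simp only: sum.neutral_const diff_0_right)
qed

lemma capacity_eq: "capacity W = info_mean"
  unfolding capacity_def
proof (rule cSup_eq_maximum)
  show "info_mean \<in> (\<lambda>P. mutual_info P W) ` input_dists"
    using uniform_input_dist mutual_info_uniform by (metis image_eqI)
qed (auto simp: mutual_info_le)

text \<open>The output law is forced to be \<open>uniform_out\<close>, so the logarithmic ratio is
  \<open>letter_info\<close> wherever \<open>W x y > 0\<close>, and its mean and variance do not
  depend on the input.\<close>

lemma dispersion_cap_achieving:
  assumes "P \<in> cap_achieving W"
  shows "dispersion P W = info_var"
proof -
  have P: "P \<in> input_dists" and r: "out_dist P W = uniform_out W"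
    using assms mutual_info_le(2)[of P] by (auto simp: cap_achieving_def capacity_eq)
  have P1: "(\<Sum>x\<in>UNIV. P x) = 1"
    using P by (auto simp: input_dists_def)
  have ln: "W x y * \<psi> (ln (W x y / uniform_out W y)) = W x y * \<psi> (letter_info W y)" for x y and \<psi> :: "real \<Rightarrow> real"
  proof (cases "0 < W x y")
    case True
    then have "0 < uniform_out W y"
      using uniform_out_nonneg[of y] uniform_out_eq_0[of y x] by fastforce
    then show ?thesis
      by (simp add: channel_eq_letter_info[OF True])
  next
    case False
    then have "W x y = 0" using channel_nonneg[of x y] by simp
    then show ?thesis by simp
  qed
  have "cond_div P W x = info_mean" for x
    unfolding cond_div_def r ln[of x _ "\<lambda>t. t"] info_mean_def by (rule letter_info_law)
  then have "dispersion P W = (\<Sum>x\<in>UNIV. P x * (\<Sum>y\<in>UNIV. W x y * (letter_info W y - info_mean)\<^sup>2))"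
    unfolding dispersion_def r mult.assoc ln[of _ _ "\<lambda>t. (t - info_mean)\<^sup>2", symmetric]
    by (simp add: sum_distrib_left)
  also have "\<dots> = info_var"
    using letter_info_law[of _ "\<lambda>t. (t - info_mean)\<^sup>2"] P1 by (simp add: info_var_def flip: sum_distrib_right)
  finally show ?thesis .
qed

lemma V_eps_eq: "V_eps \<epsilon> W = info_var"
proof -
  have "(\<lambda>_. 1 / real CARD('x)) \<in> cap_achieving W"
    using uniform_input_dist mutual_info_uniform by (simp add: cap_achieving_def capacity_eq)
  then have "(\<lambda>Q. dispersion Q W) ` cap_achieving W = {info_var}"
    using dispersion_cap_achieving by (auto intro!: image_eqI)
  then show ?thesis
    by (simp add: V_eps_def)
qed

end

end

end

section \<open>The second-order bound\<close>

text \<open>The power of 1/2 in the maximum carries the induction: a new step raises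
  \<open>1 - (1 / 2) ^ n\<close> to \<open>1 - (1 / 2) ^ Suc n\<close>. It is added only if
  \<open>t \<le> - Suc n\<close>, where \<open>exp t\<close> is below that power since
  \<open>exp 1 \<ge> 2\<close>.\<close>

lemma sum_half_pow_steps_le:
  fixes t :: real
  assumes "t \<le> 0"
  shows "(\<Sum>k=1..n. (1 / 2) ^ k * of_bool (t \<le> - real k)) \<le> 1 - max ((1 / 2) ^ n) (exp t)"
proof (induction n)
  case 0
  then show ?case using assms by simp
next
  case (Suc n)
  show ?case
  proof (cases "t \<le> - real (Suc n)")
    case True
    have "exp t \<le> exp (- real (Suc n))"
      using True by simp
    also have "\<dots> = exp (- 1) ^ Suc n"
      by (simp only: exp_of_nat_mult[symmetric]) simp
    also have "\<dots> \<le> (1 / 2) ^ Suc n"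
    proof (intro power_mono)
      have "2 \<le> exp (1 :: real)"
        using exp_ge_add_one_self[of 1] by simp
      then show "exp (- 1) \<le> (1 / 2 :: real)"
        by (simp add: exp_minus field_simps)
    qed simp
    finally show ?thesis
      using Suc True by (simp add: max_def split: if_splits)
  next
    case False
    have "max ((1 / 2) ^ Suc n) (exp t) \<le> max ((1 / 2) ^ n) (exp t)"
      by (intro max.mono power_decreasing) auto
    moreover have "(\<Sum>k=1..Suc n. (1 / 2) ^ k * of_bool (t \<le> - real k))
        = (\<Sum>k=1..n. (1 / 2 :: real) ^ k * of_bool (t \<le> - real k))"
      using False by simp
    ultimately show ?thesis using Suc by linarith
  qed
qed

lemma one_minus_min_exp_ge:
  fixes t :: real
  shows "(\<Sum>k=1..n. (1 / 2) ^ k * of_bool (t \<le> - real k)) \<le> 1 - min 1 (exp t)"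
proof (cases "t \<le> 0")
  case True
  then show ?thesis using sum_half_pow_steps_le[OF True, of n] by simp
next
  case False
  then have "(\<Sum>k=1..n. (1 / 2 :: real) ^ k * of_bool (t \<le> - real k)) = 0"
    by (intro sum.neutral) auto
  then show ?thesis by simp
qed

lemma sum_half_pow: "(\<Sum>k=1..n. (1 / 2) ^ k) = 1 - (1 / 2 :: real) ^ n"
  by (induction n) (simp_all add: field_simps)

lemma sum_times_half_pow: "(\<Sum>k=1..n. real k * (1 / 2) ^ k) = 2 - real (n + 2) * (1 / 2 :: real) ^ n"
  by (induction n) (simp_all add: field_simps)

text \<open>Bounds the weight lost when the geometric mixture is cut off after \<open>n\<close>
  terms.\<close>

lemma half_pow_le_inverse_sqrt:
  assumes "1 \<le> n"
  shows "(1 / 2) ^ n \<le> 1 / sqrt (real n)"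
proof -
  have "sqrt (real n) \<le> sqrt ((real n)\<^sup>2)"
    using assms by (intro real_sqrt_le_mono) (simp add: power2_eq_square)
  also have "\<dots> \<le> 2 ^ n"
    using of_nat_mono[OF less_imp_le[OF less_exp[of n]], where ?'a = real] by simp
  finally show ?thesis
    using assms by (simp add: power_one_over frac_le)
qed

context
  fixes p :: "'a::finite \<Rightarrow> real" and v :: "'a \<Rightarrow> real" and \<mu> \<sigma> :: real
  assumes p_nonneg: "\<And>a. 0 \<le> p a" and p_sum: "(\<Sum>a\<in>UNIV. p a) = 1"
    and mean: "(\<Sum>a\<in>UNIV. p a * v a) = \<mu>"
    and var: "(\<Sum>a\<in>UNIV. p a * (v a - \<mu>)\<^sup>2) = \<sigma>\<^sup>2" and sd_pos: "0 < \<sigma>"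
begin

lemma berry_esseen_normalized:
  "\<exists>K. \<forall>n\<ge>1. \<forall>z. \<bar>walk_expect p v n (\<lambda>s. of_bool (s \<le> real n * \<mu> + \<sigma> * sqrt (real n) * z)) - Phi z\<bar>
      \<le> K / sqrt (real n)"
proof -
  have "(\<Sum>a\<in>UNIV. p a * ((v a - \<mu>) / \<sigma>)) = ((\<Sum>a\<in>UNIV. p a * v a) - (\<Sum>a\<in>UNIV. p a) * \<mu>) / \<sigma>"
    by (simp add: sum_divide_distrib sum_subtractf sum_distrib_right right_diff_distrib diff_divide_distrib)
  then have m: "(\<Sum>a\<in>UNIV. p a * ((v a - \<mu>) / \<sigma>)) = 0"
    by (simp add: mean p_sum)
  have "(\<Sum>a\<in>UNIV. p a * ((v a - \<mu>) / \<sigma>)\<^sup>2) = (\<Sum>a\<in>UNIV. p a * (v a - \<mu>)\<^sup>2) / \<sigma>\<^sup>2"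
    by (simp add: sum_divide_distrib power_divide)
  then have v: "(\<Sum>a\<in>UNIV. p a * ((v a - \<mu>) / \<sigma>)\<^sup>2) = 1"
    using var sd_pos by simp
  have "s \<le> real n * \<mu> + \<sigma> * sqrt (real n) * z \<longleftrightarrow> (s - real n * \<mu>) / \<sigma> \<le> sqrt (real n) * z" for s z n
    using sd_pos by (simp add: pos_divide_le_eq algebra_simps)
  then show ?thesis
    using berry_esseen[OF p_nonneg p_sum m v] by (simp add: walk_expect_affine)
qed

text \<open>\<open>1 - min 1 (exp t)\<close> is the probability that \<open>t + T \<le> 0\<close> for an exponential variable \<open>T\<close>. It is
  bounded below by a geometric mixture of indicators of half-lines, to which Berry--Esseen applies.\<close>

lemma walk_expect_exp_threshold:
  "\<exists>K. \<forall>n\<ge>1. \<forall>z. Phi z - K / sqrt (real n)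
     \<le> walk_expect p v n (\<lambda>s. 1 - min 1 (exp (s - (real n * \<mu> + \<sigma> * sqrt (real n) * z))))"
proof -
  obtain K where K: "\<And>n z. 1 \<le> n \<Longrightarrow>
      \<bar>walk_expect p v n (\<lambda>s. of_bool (s \<le> real n * \<mu> + \<sigma> * sqrt (real n) * z)) - Phi z\<bar> \<le> K / sqrt (real n)"
    using berry_esseen_normalized by blast
  have K0: "0 \<le> K"
    using K[of 1 0] by simp
  \<comment> \<open>Berry--Esseen gives \<open>K\<close>, the missing weight gives 1, and
    \<open>2 / \<sigma>\<close> comes from the mean shift: the sum of \<open>k * (1 / 2) ^ k\<close>
    is at most 2.\<close>
  have "Phi z - (K + 1 + 2 / \<sigma>) / sqrt (real n)
     \<le> walk_expect p v n (\<lambda>s. 1 - min 1 (exp (s - (real n * \<mu> + \<sigma> * sqrt (real n) * z))))" if n: "1 \<le> n" for n z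
  proof -
    let ?a = "real n * \<mu> + \<sigma> * sqrt (real n) * z"
    define q where "q = sqrt (real n)"
    have q: "0 < q" using n by (simp add: q_def)
    have shift: "s - ?a \<le> - real k \<longleftrightarrow> s \<le> real n * \<mu> + \<sigma> * sqrt (real n) * (z - real k / (\<sigma> * q))" for s k
    proof -
      have "\<sigma> * sqrt (real n) * (z - real k / (\<sigma> * q)) = \<sigma> * sqrt (real n) * z - real k"
        using q sd_pos by (simp add: q_def field_simps)
      then show ?thesis by linarith
    qed
    have "Phi z - (K + 1 + 2 / \<sigma>) / q \<le> (Phi z - K / q) - (1 / 2) ^ n - 2 / (\<sigma> * q)"
      using half_pow_le_inverse_sqrt[OF n] q sd_pos by (simp add: add_divide_distrib q_def)
    also have "\<dots> \<le> (Phi z - K / q) * (1 - (1 / 2) ^ n) - 2 / (\<sigma> * q)"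
    proof -
      have "(Phi z - K / q) * (1 / 2) ^ n \<le> 1 * (1 / 2) ^ n"
        using K0 q Phi_le_1[of z] by (intro mult_right_mono) (auto intro: order_trans[of _ "Phi z"])
      then show ?thesis by (simp add: right_diff_distrib)
    qed
    also have "\<dots> \<le> (Phi z - K / q) * (\<Sum>k=1..n. (1 / 2) ^ k) - 1 / (\<sigma> * q) * (\<Sum>k=1..n. real k * (1 / 2) ^ k)"
    proof -
      have "1 / (\<sigma> * q) * (\<Sum>k=1..n. real k * (1 / 2) ^ k) \<le> 1 / (\<sigma> * q) * 2"
        unfolding sum_times_half_pow using q sd_pos by (intro mult_left_mono) auto
      then show ?thesis unfolding sum_half_pow by simp
    qed
    also have "\<dots> = (\<Sum>k=1..n. (1 / 2) ^ k * (Phi z - real k / (\<sigma> * q) - K / q))"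
      by (simp add: sum_distrib_left sum_distrib_right sum_subtractf[symmetric] algebra_simps)
    also have "\<dots> \<le> (\<Sum>k=1..n. (1 / 2) ^ k * walk_expect p v n (\<lambda>s. of_bool (s - ?a \<le> - real k)))"
    proof (intro sum_mono mult_left_mono)
      fix k
      have "0 \<le> real k / (\<sigma> * q)" using q sd_pos by simp
      then show "Phi z - real k / (\<sigma> * q) - K / q \<le> walk_expect p v n (\<lambda>s. of_bool (s - ?a \<le> - real k))"
        unfolding shift using K[OF n, of "z - real k / (\<sigma> * q)"] Phi_diff_le[of "z - real k / (\<sigma> * q)" z]
        by (simp add: q_def)
    qed simp
    also have "\<dots> = walk_expect p v n (\<lambda>s. \<Sum>k=1..n. (1 / 2) ^ k * of_bool (s - ?a \<le> - real k))"
      by (simp only: walk_expect_sum walk_expect_cmult)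
    also have "\<dots> \<le> walk_expect p v n (\<lambda>s. 1 - min 1 (exp (s - ?a)))"
      by (intro walk_expect_mono[OF p_nonneg p_sum] one_minus_min_exp_ge)
    finally show ?thesis by (simp add: q_def)
  qed
  then show ?thesis by blast
qed

end

text \<open>Converts an error of order \<open>1 / sqrt N\<close> in probability into a quantile
  shift of the same order; \<open>t \<le> 1\<close> keeps the density bounded below.\<close>

lemma Phi_diff_ge:
  assumes "0 \<le> t" and "t \<le> 1"
  shows "t * std_normal_density (\<bar>z\<bar> + 1) \<le> Phi (z + t) - Phi z"
proof (cases "t = 0")
  case False
  then obtain y where y: "z < y" "y < z + t" "Phi (z + t) - Phi z = t * std_normal_density y"
    using MVT2[of z "z + t" Phi std_normal_density] assms Phi_has_real_derivative by auto
  have "\<bar>y\<bar> \<le> \<bar>z\<bar> + 1"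
    using y assms by linarith
  then have "y\<^sup>2 \<le> (\<bar>z\<bar> + 1)\<^sup>2"
    using abs_le_square_iff[of y "\<bar>z\<bar> + 1"] by simp
  then have "std_normal_density (\<bar>z\<bar> + 1) \<le> std_normal_density y"
    unfolding std_normal_density_def by (intro mult_left_mono) auto
  then show ?thesis
    unfolding y(3) using assms by (intro mult_left_mono)
qed simp

lemma fb_code_exists_1:
  assumes "0 < \<epsilon>"
  shows "fb_code_exists W N 1 \<epsilon>"
  unfolding fb_code_exists_def fb_avg_error_def
  by (rule exI, rule exI[of _ "\<lambda>_. 1"]) (use assms in simp)

text \<open>The bound makes the set under \<open>Max\<close> finite, and the one-message code with
  rate 0 makes it nonempty, so the maximum is attained by a code.\<close>

lemma ln_M_star_fb_le:
  assumes "0 < \<epsilon>" and bound: "\<And>M. 1 \<le> M \<Longrightarrow> fb_code_exists W N M \<epsilon> \<Longrightarrow> ln (real M) \<le> b"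
  shows "ln (real (M_star_fb W N \<epsilon>)) \<le> b"
proof -
  let ?S = "{M. \<exists>R::real. M = nat \<lceil>exp (real N * R)\<rceil> \<and> fb_code_exists W N M \<epsilon>}"
  have pos: "1 \<le> M" if M: "M \<in> ?S" for M
  proof -
    obtain R where "M = nat \<lceil>exp (real N * R)\<rceil>" using M by auto
    moreover have "0 < \<lceil>exp (real N * R)\<rceil>" by simp
    ultimately show ?thesis by linarith
  qed
  have "M \<le> nat \<lceil>exp b\<rceil>" if "M \<in> ?S" for M
  proof -
    have "ln (real M) \<le> b" using bound pos[OF that] that by blast
    then have "real M \<le> exp b"
      using pos[OF that] ln_ge_iff[of "real M"] by (metis exp_le_cancel_iff exp_ln of_nat_0_less_iff less_le_trans zero_less_one)
    then show ?thesis by linarith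
  qed
  then have "finite ?S"
    by (intro finite_subset[of ?S "{..nat \<lceil>exp b\<rceil>}"]) auto
  moreover have "1 \<in> ?S"
    using fb_code_exists_1[OF assms(1), of W N] by (auto intro!: exI[of _ 0])
  ultimately have "M_star_fb W N \<epsilon> \<in> ?S"
    unfolding M_star_fb_def by (intro Max_in) blast+
  then show ?thesis
    using bound pos by blast
qed

theorem theorem3:
  fixes W :: "'x::finite \<Rightarrow> 'y::finite \<Rightarrow> real" and \<epsilon> :: real
  assumes "0 < \<epsilon>" and "\<epsilon> < 1"
    and "channel W" and "symmetric_channel W" and "singular_channel W"
    and "V_eps \<epsilon> W > 0"
  shows "\<exists>K>0. \<forall>N::nat. ln (real (M_star_fb W N \<epsilon>))
           \<le> real N * capacity W + sqrt (real N * V_eps \<epsilon> W) * Phi_inv \<epsilon> + K"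
proof -
  define C where "C = capacity W"
  define \<sigma> where "\<sigma> = sqrt (V_eps \<epsilon> W)"
  have \<sigma>: "0 < \<sigma>" "\<sigma>\<^sup>2 = V_eps \<epsilon> W"
    using assms(6) by (simp_all add: \<sigma>_def)
  note ch = assms(3,5,4)
  have mean: "(\<Sum>y\<in>UNIV. uniform_out W y * letter_info W y) = C"
    unfolding C_def capacity_eq[OF ch] info_mean_def[OF ch] ..
  have var: "(\<Sum>y\<in>UNIV. uniform_out W y * (letter_info W y - C)\<^sup>2) = \<sigma>\<^sup>2"
    unfolding \<sigma> C_def capacity_eq[OF ch] V_eps_eq[OF ch] info_var_def[OF ch] ..
  obtain K1 where K1: "\<And>N z. 1 \<le> N \<Longrightarrow> Phi z - K1 / sqrt (real N)
      \<le> walk_expect (uniform_out W) (letter_info W) N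
          (\<lambda>s. 1 - min 1 (exp (s - (real N * C + \<sigma> * sqrt (real N) * z))))"
    using walk_expect_exp_threshold[OF uniform_out_nonneg[OF assms(3)] uniform_out_sum[OF assms(3)] mean var \<sigma>(1)]
    by blast
  define z0 where "z0 = Phi_inv \<epsilon>"
  have z0: "Phi z0 = \<epsilon>"
    unfolding z0_def by (rule Phi_Phi_inv[OF assms(1,2)])
  define d where "d = std_normal_density (\<bar>z0\<bar> + 1)"
  have d: "0 < d" by (simp add: d_def normal_density_pos)
  \<comment> \<open>With a quantile shift \<open>t = K2 / sqrt N\<close>, the gain
    \<open>t * d\<close> strictly exceeds the error \<open>K1 / sqrt N\<close>.\<close>
  define K2 where "K2 = (\<bar>K1\<bar> + 1) / d"
  have K2: "0 < K2" using d by (simp add: K2_def)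
  define b where "b N = real N * C + sqrt (real N * V_eps \<epsilon> W) * z0" for N
  have b: "b N = real N * C + \<sigma> * sqrt (real N) * z0" for N
    by (simp add: b_def \<sigma>_def real_sqrt_mult)
  have large: "ln (real (M_star_fb W N \<epsilon>)) \<le> b N + \<sigma> * K2" if N: "1 \<le> N" "K2 \<le> sqrt (real N)" for N
  proof (rule ln_M_star_fb_le[OF assms(1)])
    fix M :: nat assume M: "1 \<le> M" "fb_code_exists W N M \<epsilon>"
    have q: "0 < sqrt (real N)" using N by simp
    \<comment> \<open>Chosen so that the threshold of the exponential bound is exactly
      \<open>ln M\<close>.\<close>
    define z where "z = (ln (real M) - real N * C) / (\<sigma> * sqrt (real N))"
    have a: "real N * C + \<sigma> * sqrt (real N) * z = ln (real M)"
      using q \<sigma> by (simp add: z_def)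
    define t where "t = K2 / sqrt (real N)"
    have t: "0 \<le> t" "t \<le> 1" using K2 q N by (simp_all add: t_def)
    from M(2) obtain f dec where "fb_avg_error W N M f dec \<le> \<epsilon>"
      unfolding fb_code_exists_def by blast
    then have "Phi z - K1 / sqrt (real N) \<le> \<epsilon>"
      using K1[OF N(1), of z] feedback_converse[OF ch M(1), of N f dec \<epsilon>] unfolding a by linarith
    also have "\<epsilon> \<le> Phi (z0 + t) - t * d"
      using Phi_diff_ge[OF t, of z0] by (simp add: z0 d_def)
    also have "t * d = (\<bar>K1\<bar> + 1) / sqrt (real N)"
      using d by (simp add: t_def K2_def)
    finally have "Phi z \<le> Phi (z0 + t) - (\<bar>K1\<bar> + 1 - K1) / sqrt (real N)"
      by (simp add: diff_divide_distrib add_divide_distrib)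
    moreover have "0 < (\<bar>K1\<bar> + 1 - K1) / sqrt (real N)"
      using q by (intro divide_pos_pos) linarith
    ultimately have "Phi z < Phi (z0 + t)" by linarith
    then have "z \<le> z0 + t"
      using Phi_mono[of "z0 + t" z] by linarith
    then have "\<sigma> * sqrt (real N) * z \<le> \<sigma> * sqrt (real N) * (z0 + t)"
      using \<sigma> q by (intro mult_left_mono) auto
    also have "\<dots> = \<sigma> * sqrt (real N) * z0 + \<sigma> * K2"
      using q by (simp add: t_def distrib_left)
    finally show "ln (real M) \<le> b N + \<sigma> * K2"
      using a by (simp add: b)
  qed
  \<comment> \<open>Beyond \<open>N0\<close> the shift \<open>t\<close> is at most 1; the finitely
    many smaller blocklengths, including 0, are absorbed into \<open>K3\<close>.\<close>
  define N0 where "N0 = nat \<lceil>K2\<^sup>2\<rceil>"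
  define K3 where "K3 = (\<Sum>N\<le>N0. \<bar>ln (real (M_star_fb W N \<epsilon>)) - b N\<bar>)"
  have K3: "0 \<le> K3" by (simp add: K3_def sum_nonneg)
  have "ln (real (M_star_fb W N \<epsilon>)) \<le> b N + (\<sigma> * K2 + K3)" for N
  proof (cases "N \<le> N0")
    case True
    then have "\<bar>ln (real (M_star_fb W N \<epsilon>)) - b N\<bar> \<le> K3"
      unfolding K3_def by (intro member_le_sum) auto
    moreover have "0 < \<sigma> * K2" using \<sigma> K2 by simp
    ultimately show ?thesis by linarith
  next
    case False
    then have "K2\<^sup>2 \<le> real N" unfolding N0_def by linarith
    then have "K2 \<le> sqrt (real N)" by (rule real_le_rsqrt)
    then show ?thesis using large[of N] False K3 by linarith
  qed
  moreover have "0 < \<sigma> * K2 + K3" using \<sigma> K2 K3 by (simp add: add_pos_nonneg)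
  ultimately show ?thesis
    unfolding b_def z0_def C_def by (intro exI[of _ "\<sigma> * K2 + K3"]) (simp add: add.assoc)
qed

end
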